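(* For every prime $p\ge 10^{5}$ there is a marking $\mathfrak m$ of the lines of $\mathbb F_p^2$, with $|\mathfrak m(\ell)|=\lceil\sqrt{2p}\rceil+1$ for every line $\ell$, such that the lattice $P_{p,\mathfrak m}$ admits no winning dot-algebra tree. Consequently the Non-Cancelling Intersections (NCI) conjecture, i.e. the assertion that every finite lattice admits a winning dot-algebra tree, is false.
   Context: All posets are finite. In a lattice $P$ with top $\top$: an ancestor (descendant) of $v$ is an element strictly above (below) $v$; parents are upper covers, children are lower covers. $\downarrow v=\{u\in P: u\le v\}$. The level of $v$ is the length of a longest upward path (chain) starting at $v$, so $\top$ has level $0$. The Möbius function is $\mu(\top)=1$, $\mu(v)=-\sum_{u>v}\mu(u)$. For $v\ne\top$ put $S_v:=\downarrow v$. Dot-algebra tree (da-tree) for a lattice $P$: a finite rooted binary tree in which every leaf is labeled either with the symbol $\emptyset$ or with some $v\in P$ with $v\neq\top$ and $\mu(v)\neq0$, and every internal node is labeled $+$ or $-$ and has a left and a right child. Each node $u$ has a state $X_u\subseteq P\setminus\{\top\}$ defined bottom-up: a leaf labeled $\emptyset$ has $X_u=\emptyset$; a leaf labeled $v$ has $X_u=S_v$; if $u$ is internal with left child $u_1$ and right child $u_2$, then if $u$ is labeled $+$ it is required that $X_{u_1}\cap X_{u_2}=\emptyset$ and $X_u:=X_{u_1}\cup X_{u_2}$; if $u$ is labeled $-$ it is required that $X_{u_2}\subseteq X_{u_1}$ and $X_u:=X_{u_1}\setminus X_{u_2}$. The da-tree is winning if the state of its root is $P\setminus\{\top\}$. The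 NCI conjecture is taken in its lattice formulation: every finite lattice has a winning da-tree. Markings: for a prime $p$, the lines of $\mathbb F_p^2$ are its $p^2+p$ affine lines. A marking is a map $\mathfrak m$ assigning to every line $\ell$ a set $\mathfrak m(\ell)\subseteq\ell$ of points (marked for $\ell$). The lattice $P_{p,\mathfrak m}$: let $w:=\lceil\sqrt{2p}\rceil+1$ and let $\mathfrak m$ satisfy $|\mathfrak m(\ell)|=w$ for every line $\ell$. The elements of $P_{p,\mathfrak m}$ are: $\top$; one level-1 element $a_q$ for each point $q\in\mathbb F_p^2$ (identified with $q$); for every line $\ell$, $p-1$ level-2 elements $c_{\ell,1},\dots,c_{\ell,p-1}$; for every line $\ell$ one level-3 element $b_\ell$; and a bottom $\bot$. The cover relations are: $\top$ covers every $a_q$; each $c_{\ell,z}$ has exactly two parents $a_q,a_{q'}$, where $q\ne q'$ are points of $\mathfrak m(\ell)$, the pairs $\{q,q'\}$ for $z=1,\dots,p-1$ being pairwise distinct and together covering all of $\mathfrak m(\ell)$ (an arbitrary fixed choice of such pairs); the only child of $c_{\ell,z}$ is $b_\ell$; the parents of $b_\ell$ are the $c_{\ell,z}$ and the $a_q$ with $q\in\ell\setminus\mathfrak m(\ell)$, so that the level-1 ancestors of $b_\ell$ are exactly the points of $\ell$; $\bot$ is covered by all $b_\ell$. One has $\mu(b_\ell)=0$ for all $\ell$. *)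

theory Defs
  imports Complex_Main "HOL-Algebra.Lattice" "HOL-Number_Theory.Residues"
begin

definition fin_lattice :: "('a, 'b) gorder_scheme \<Rightarrow> bool" where
  "fin_lattice L \<longleftrightarrow> lattice L \<and> finite (carrier L) \<and> carrier L \<noteq> {}"

text \<open>
  The guard is there only for termination; it makes \<open>moebius\<close> vanish outside finite posets,
  where it is never used.
\<close>

function moebius :: "('a, 'b) gorder_scheme \<Rightarrow> 'a \<Rightarrow> int" where
  "moebius L v =
    (if partial_order L \<and> finite (carrier L) \<and> v \<in> carrier L
     then (if v = \<top>\<^bsub>L\<^esub> then 1 else - (\<Sum>u | u \<in> carrier L \<and> v \<sqsubset>\<^bsub>L\<^esub> u. moebius L u))
     else 0)"
  by pat_completeness auto
termination
proof (relation "measure (\<lambda>(L, v). card {u \<in> carrier L. v \<sqsubset>\<^bsub>L\<^esub> u})")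
  fix L :: "('a, 'b) gorder_scheme" and v u :: 'a
  assume L: "partial_order L \<and> finite (carrier L) \<and> v \<in> carrier L"
    and u: "u \<in> {u. u \<in> carrier L \<and> v \<sqsubset>\<^bsub>L\<^esub> u}"
  then interpret partial_order L by simp
  have "{w \<in> carrier L. u \<sqsubset>\<^bsub>L\<^esub> w} \<subset> {w \<in> carrier L. v \<sqsubset>\<^bsub>L\<^esub> w}"
  proof
    show "{w \<in> carrier L. u \<sqsubset>\<^bsub>L\<^esub> w} \<subseteq> {w \<in> carrier L. v \<sqsubset>\<^bsub>L\<^esub> w}"
      using L u lless_trans by blast
    have "\<not> u \<sqsubset>\<^bsub>L\<^esub> u"
      by (simp add: lless_def eq_is_equal)
    then show "{w \<in> carrier L. u \<sqsubset>\<^bsub>L\<^esub> w} \<noteq> {w \<in> carrier L. v \<sqsubset>\<^bsub>L\<^esub> w}"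
      using u by blast
  qed
  then show "((L, u), (L, v)) \<in> measure (\<lambda>(L, v). card {u \<in> carrier L. v \<sqsubset>\<^bsub>L\<^esub> u})"
    using L by (simp add: psubset_card_mono)
qed simp

declare moebius.simps [simp del]

datatype 'a da_tree =
  Empty_Leaf
| Leaf 'a
| Plus "'a da_tree" "'a da_tree"
| Minus "'a da_tree" "'a da_tree"

definition down_set :: "('a, 'b) gorder_scheme \<Rightarrow> 'a \<Rightarrow> 'a set" where
  "down_set L v = {u \<in> carrier L. u \<sqsubseteq>\<^bsub>L\<^esub> v}"

primrec da_state :: "('a, 'b) gorder_scheme \<Rightarrow> 'a da_tree \<Rightarrow> 'a set" where
  "da_state L Empty_Leaf = {}"
| "da_state L (Leaf v) = down_set L v"
| "da_state L (Plus t1 t2) = da_state L t1 \<union> da_state L t2"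
| "da_state L (Minus t1 t2) = da_state L t1 - da_state L t2"

primrec is_da_tree :: "('a, 'b) gorder_scheme \<Rightarrow> 'a da_tree \<Rightarrow> bool" where
  "is_da_tree L Empty_Leaf \<longleftrightarrow> True"
| "is_da_tree L (Leaf v) \<longleftrightarrow> v \<in> carrier L \<and> v \<noteq> \<top>\<^bsub>L\<^esub> \<and> moebius L v \<noteq> 0"
| "is_da_tree L (Plus t1 t2) \<longleftrightarrow>
     is_da_tree L t1 \<and> is_da_tree L t2 \<and> da_state L t1 \<inter> da_state L t2 = {}"
| "is_da_tree L (Minus t1 t2) \<longleftrightarrow>
     is_da_tree L t1 \<and> is_da_tree L t2 \<and> da_state L t2 \<subseteq> da_state L t1"

definition winning :: "('a, 'b) gorder_scheme \<Rightarrow> 'a da_tree \<Rightarrow> bool" where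
  "winning L t \<longleftrightarrow> is_da_tree L t \<and> da_state L t = carrier L - {\<top>\<^bsub>L\<^esub>}"

text \<open>
  Every finite lattice is isomorphic to one whose carrier is a finite set of natural numbers,
  so quantifying over such lattices covers all finite lattices.
\<close>

definition NCI_conjecture :: bool where
  "NCI_conjecture \<longleftrightarrow> (\<forall>L :: nat gorder. fin_lattice L \<longrightarrow> (\<exists>t. winning L t))"

type_synonym point = "int \<times> int"

definition plane :: "nat \<Rightarrow> point set" where
  "plane p = carrier (residue_ring (int p)) \<times> carrier (residue_ring (int p))"

definition affine_lines :: "nat \<Rightarrow> point set set" where
  "affine_lines p = (let F = residue_ring (int p) in
     {{(x, y). (x, y) \<in> plane p \<and> a \<otimes>\<^bsub>F\<^esub> x \<oplus>\<^bsub>F\<^esub> b \<otimes>\<^bsub>F\<^esub> y = c} | a b c.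
        a \<in> carrier F \<and> b \<in> carrier F \<and> c \<in> carrier F \<and> (a, b) \<noteq> (\<zero>\<^bsub>F\<^esub>, \<zero>\<^bsub>F\<^esub>)})"

definition marking :: "nat \<Rightarrow> (point set \<Rightarrow> point set) \<Rightarrow> bool" where
  "marking p m \<longleftrightarrow> (\<forall>l\<in>affine_lines p. m l \<subseteq> l)"

text \<open>
  \<open>pair_choice p m pr\<close>: \<open>pr l z = {q, q'}\<close> is the set of points whose level-1 elements are the
  two parents of the level-2 element with indices \<open>l\<close> and \<open>z\<close>.
\<close>

definition pair_choice ::
    "nat \<Rightarrow> (point set \<Rightarrow> point set) \<Rightarrow> (point set \<Rightarrow> nat \<Rightarrow> point set) \<Rightarrow> bool" where
  "pair_choice p m pr \<longleftrightarrow>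
     (\<forall>l\<in>affine_lines p.
        (\<forall>z\<in>{1..p - 1}. pr l z \<subseteq> m l \<and> card (pr l z) = 2) \<and>
        inj_on (pr l) {1..p - 1} \<and>
        (\<Union>z\<in>{1..p - 1}. pr l z) = m l)"

text \<open>The elements named \<open>a\<^sub>q\<close>, \<open>c\<^sub>l\<^sub>,\<^sub>z\<close> and \<open>b\<^sub>l\<close> are \<open>A q\<close>, \<open>C l z\<close> and \<open>B l\<close>.\<close>

datatype elt = Top | A point | C "point set" nat | B "point set" | Bot

text \<open>\<open>covered p m pr x y\<close> means that \<open>y\<close> is a parent of \<open>x\<close>.\<close>

inductive covered ::
    "nat \<Rightarrow> (point set \<Rightarrow> point set) \<Rightarrow> (point set \<Rightarrow> nat \<Rightarrow> point set) \<Rightarrow> elt \<Rightarrow> elt \<Rightarrow> bool"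
  for p m pr where
  "q \<in> plane p \<Longrightarrow> covered p m pr (A q) Top"
| "l \<in> affine_lines p \<Longrightarrow> z \<in> {1..p - 1} \<Longrightarrow> q \<in> pr l z \<Longrightarrow> covered p m pr (C l z) (A q)"
| "l \<in> affine_lines p \<Longrightarrow> z \<in> {1..p - 1} \<Longrightarrow> covered p m pr (B l) (C l z)"
| "l \<in> affine_lines p \<Longrightarrow> q \<in> l - m l \<Longrightarrow> covered p m pr (B l) (A q)"
| "l \<in> affine_lines p \<Longrightarrow> covered p m pr Bot (B l)"

definition P_lattice ::
    "nat \<Rightarrow> (point set \<Rightarrow> point set) \<Rightarrow> (point set \<Rightarrow> nat \<Rightarrow> point set) \<Rightarrow> elt gorder" where
  "P_lattice p m pr =
     \<lparr>carrier = {Top, Bot} \<union> A ` plane p \<union> {C l z | l z. l \<in> affine_lines p \<and> z \<in> {1..p - 1}}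
                \<union> B ` affine_lines p,
      eq = (=),
      le = (covered p m pr)\<^sup>*\<^sup>*\<rparr>"

end

theory Submission
  imports Defs
begin

text \<open>
  Since \<open>B l\<close> has Moebius value 0, every state of a da-tree is an integer combination of the sets
  \<open>S\<^sub>v\<close> with \<open>v \<noteq> B l\<close>. Each of these satisfies the same linear equation, which expresses membership
  of \<open>B l\<close> by membership of the \<open>A q\<close> with \<open>q \<in> l\<close> and of the \<open>C l z\<close>. If a state contains at
  least two points of \<open>l\<close> but none marked for \<open>l\<close>, the equation makes the indicator of \<open>B l\<close> at
  least 2. So the points of a state meet \<open>m l\<close> whenever they meet \<open>l\<close> at least twice.

  A winning tree has a node whose state has between \<open>4 * p\<close> and \<open>8 * p\<close> points, since \<open>-\<close> nodes do
  not increase the number of points and \<open>+\<close> nodes add the two numbers. Such a point set meets at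
  least half of the \<open>p\<^sup>2\<close> non-vertical lines in at least 2 and at most 16 points (Chebyshev), and
  since \<open>m l\<close> has only about \<open>sqrt (2 * p)\<close> points, a random marking very likely misses it on one
  of these lines. A union bound over all point sets of this size gives one marking that works for
  all of them.
\<close>

section \<open>Lattices\<close>

lemma partial_order_of_embedding:
  fixes L :: "('a, 'b) gorder_scheme" and e :: "'a \<Rightarrow> 'c set"
  assumes "eq L = (=)"
    and "inj_on e (carrier L)"
    and "\<And>x y. x \<in> carrier L \<Longrightarrow> y \<in> carrier L \<Longrightarrow> x \<sqsubseteq>\<^bsub>L\<^esub> y \<longleftrightarrow> e y \<subseteq> e x"
  shows "partial_order L"
  by unfold_locales (use assms in \<open>auto dest: inj_onD\<close>)

text \<open>The order is reverse inclusion, so the join is the intersection. The meet is the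
  intersection over all common lower bounds, a finite family that contains \<open>b\<close> and is
  therefore nonempty.\<close>

lemma lattice_of_inter_closed:
  fixes L :: "('a, 'b) gorder_scheme" and e :: "'a \<Rightarrow> 'c set"
  assumes eq: "eq L = (=)" and fin: "finite (carrier L)"
    and inj: "inj_on e (carrier L)"
    and le: "\<And>x y. x \<in> carrier L \<Longrightarrow> y \<in> carrier L \<Longrightarrow> x \<sqsubseteq>\<^bsub>L\<^esub> y \<longleftrightarrow> e y \<subseteq> e x"
    and inter: "\<And>x y. x \<in> carrier L \<Longrightarrow> y \<in> carrier L \<Longrightarrow> \<exists>z\<in>carrier L. e z = e x \<inter> e y"
    and bot: "b \<in> carrier L" "\<And>x. x \<in> carrier L \<Longrightarrow> e x \<subseteq> e b"
  shows "lattice L"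
proof -
  interpret partial_order L
    using partial_order_of_embedding[OF eq inj le] .
  have inters: "\<exists>z\<in>carrier L. e z = \<Inter>(e ` D)" if "finite D" "D \<noteq> {}" "D \<subseteq> carrier L" for D
    using that
  proof (induction D rule: finite_ne_induct)
    case (insert x D)
    then obtain z where "z \<in> carrier L" "e z = \<Inter>(e ` D)"
      by auto
    then show ?case
      using inter[of x z] insert.prems by auto
  qed auto
  show ?thesis
  proof unfold_locales
    fix x y assume xy: "x \<in> carrier L" "y \<in> carrier L"
    obtain z where z: "z \<in> carrier L" "e z = e x \<inter> e y"
      using inter[OF xy] by blast
    have "least L z (Upper L {x, y})"
    proof (rule least_UpperI)
      fix u assume "u \<in> Upper L {x, y}"
      then have "u \<in> carrier L" "x \<sqsubseteq>\<^bsub>L\<^esub> u" "y \<sqsubseteq>\<^bsub>L\<^esub> u"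
        using xy by (auto simp: Upper_def)
      then show "z \<sqsubseteq>\<^bsub>L\<^esub> u"
        using le xy z by auto
    qed (use le xy z in auto)
    then show "\<exists>s. least L s (Upper L {x, y})" ..
    define D where "D = Lower L {x, y}"
    have D: "D = {u \<in> carrier L. e x \<union> e y \<subseteq> e u}"
      using xy le by (auto simp: D_def Lower_def)
    have "finite D" "D \<noteq> {}" "D \<subseteq> carrier L"
      using fin bot xy by (auto simp: D)
    then obtain w where w: "w \<in> carrier L" "e w = \<Inter>(e ` D)"
      using inters by blast
    have "greatest L w (Lower L {x, y})"
    proof (rule greatest_LowerI)
      fix u assume "u \<in> Lower L {x, y}"
      then have "u \<in> D"
        by (simp add: D_def)
      then show "u \<sqsubseteq>\<^bsub>L\<^esub> w"
        using le w by (auto simp: D)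
    next
      fix u assume "u \<in> {x, y}"
      then show "w \<sqsubseteq>\<^bsub>L\<^esub> u"
        using le xy w by (auto simp: D)
    qed (use xy w in auto)
    then show "\<exists>s. greatest L s (Lower L {x, y})" ..
  qed
qed

lemma top_eqI:
  assumes "partial_order L" "greatest L t (carrier L)"
  shows "\<top>\<^bsub>L\<^esub> = t"
  unfolding top_def using assms partial_order.greatest_unique by (metis someI)

lemma fin_lattice_top:
  assumes "fin_lattice L"
  shows "greatest L \<top>\<^bsub>L\<^esub> (carrier L)"
proof -
  interpret lattice L
    using assms by (simp add: fin_lattice_def)
  have "\<exists>s. least L s (Upper L (carrier L))"
    using finite_sup_least[of "carrier L"] assms by (auto simp: fin_lattice_def)
  then obtain s where "least L s (Upper L (carrier L))" ..
  then have "greatest L s (carrier L)"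
    by (auto simp: least_def greatest_def Upper_def)
  then show ?thesis
    unfolding top_def by (metis someI)
qed

section \<open>Transport of lattices and da-trees along an injection\<close>

definition push_order :: "('a \<Rightarrow> 'c) \<Rightarrow> ('a, 'b) gorder_scheme \<Rightarrow> 'c gorder" where
  "push_order h L =
     \<lparr>carrier = h ` carrier L, eq = (=),
      le = (\<lambda>x y. inv_into (carrier L) h x \<sqsubseteq>\<^bsub>L\<^esub> inv_into (carrier L) h y)\<rparr>"

context
  fixes L :: "('a, 'b) gorder_scheme" and h :: "'a \<Rightarrow> 'c" and M :: "'c gorder"
  assumes L: "fin_lattice L" and inj: "inj_on h (carrier L)"
  defines "M \<equiv> push_order h L"
begin

lemma carrier_push: "carrier M = h ` carrier L"
  by (simp add: M_def push_order_def)

lemma eq_push: "eq M = (=)"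
  by (simp add: M_def push_order_def)

lemma eq_base: "eq L = (=)"
proof -
  interpret lattice L
    using L by (simp add: fin_lattice_def)
  show ?thesis
    by (rule eq_is_equal)
qed

lemma le_push:
  "x \<in> carrier L \<Longrightarrow> y \<in> carrier L \<Longrightarrow> h x \<sqsubseteq>\<^bsub>M\<^esub> h y \<longleftrightarrow> x \<sqsubseteq>\<^bsub>L\<^esub> y"
  using inj by (simp add: M_def push_order_def)

lemma lless_push:
  "x \<in> carrier L \<Longrightarrow> y \<in> carrier L \<Longrightarrow> h x \<sqsubset>\<^bsub>M\<^esub> h y \<longleftrightarrow> x \<sqsubset>\<^bsub>L\<^esub> y"
  by (simp add: lless_def le_push eq_push eq_base inj_on_eq_iff[OF inj])

lemma fin_lattice_push: "fin_lattice M"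
proof -
  interpret L: lattice L
    using L by (simp add: fin_lattice_def)
  have antisym: "h x = h y" if "x \<sqsubseteq>\<^bsub>L\<^esub> y" "y \<sqsubseteq>\<^bsub>L\<^esub> x" "x \<in> carrier L" "y \<in> carrier L" for x y
    using L.le_antisym that by blast
  interpret partial_order M
    by unfold_locales (auto simp: eq_push carrier_push le_push intro: L.le_trans antisym)
  have "lattice M"
  proof unfold_locales
    fix x y assume "x \<in> carrier M" "y \<in> carrier M"
    then obtain a b where ab: "a \<in> carrier L" "b \<in> carrier L" "x = h a" "y = h b"
      by (auto simp: carrier_push)
    obtain s where "least L s (Upper L {a, b})"
      using L.sup_of_two_exists ab by blast
    then have "least M (h s) (Upper M {x, y})"
      using ab by (auto simp: least_def Upper_def carrier_push le_push)
    then show "\<exists>s. least M s (Upper M {x, y})" ..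
    obtain i where "greatest L i (Lower L {a, b})"
      using L.inf_of_two_exists ab by blast
    then have "greatest M (h i) (Lower M {x, y})"
      using ab by (auto simp: greatest_def Lower_def carrier_push le_push)
    then show "\<exists>s. greatest M s (Lower M {x, y})" ..
  qed
  then show ?thesis
    using L by (simp add: fin_lattice_def carrier_push)
qed

lemma partial_orders: "partial_order L" "partial_order M"
  using L fin_lattice_push
  unfolding fin_lattice_def lattice_def upper_semilattice_def by blast+

lemma top_push: "\<top>\<^bsub>M\<^esub> = h \<top>\<^bsub>L\<^esub>"
proof (rule top_eqI)
  show "greatest M (h \<top>\<^bsub>L\<^esub>) (carrier M)"
    using fin_lattice_top[OF L] by (auto simp: greatest_def carrier_push le_push)
qed (rule partial_orders)

text \<open>Induction on the number of elements strictly above \<open>v\<close>: the recursion for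
  the Moebius function only calls such elements, and \<open>h\<close> carries the strict up-set of
  \<open>v\<close> bijectively to that of \<open>h v\<close>.\<close>

lemma moebius_push: "v \<in> carrier L \<Longrightarrow> moebius M (h v) = moebius L v"
proof (induction "card {u \<in> carrier L. v \<sqsubset>\<^bsub>L\<^esub> u}" arbitrary: v rule: less_induct)
  case less
  interpret L: partial_order L
    by (rule partial_orders)
  have top: "\<top>\<^bsub>L\<^esub> \<in> carrier L"
    using fin_lattice_top[OF L] by (auto simp: greatest_def)
  have fin: "finite (carrier L)"
    using L by (simp add: fin_lattice_def)
  have above: "{u. u \<in> carrier M \<and> h v \<sqsubset>\<^bsub>M\<^esub> u} = h ` {u \<in> carrier L. v \<sqsubset>\<^bsub>L\<^esub> u}"
    using less.prems by (auto simp: carrier_push lless_push)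
  have "(\<Sum>u | u \<in> carrier M \<and> h v \<sqsubset>\<^bsub>M\<^esub> u. moebius M u) =
        (\<Sum>u | u \<in> carrier L \<and> v \<sqsubset>\<^bsub>L\<^esub> u. moebius M (h u))"
    unfolding above by (rule sum.reindex_cong[of h]) (auto intro: inj_on_subset[OF inj])
  also have "\<dots> = (\<Sum>u | u \<in> carrier L \<and> v \<sqsubset>\<^bsub>L\<^esub> u. moebius L u)"
  proof (rule sum.cong[OF refl])
    fix u assume "u \<in> {u. u \<in> carrier L \<and> v \<sqsubset>\<^bsub>L\<^esub> u}"
    then have u: "u \<in> carrier L" "v \<sqsubset>\<^bsub>L\<^esub> u"
      by auto
    have "\<not> u \<sqsubset>\<^bsub>L\<^esub> u"
      by (simp add: lless_def L.eq_is_equal)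
    then have "{w \<in> carrier L. u \<sqsubset>\<^bsub>L\<^esub> w} \<subset> {w \<in> carrier L. v \<sqsubset>\<^bsub>L\<^esub> w}"
      using u less.prems L.lless_trans by blast
    then show "moebius M (h u) = moebius L u"
      using u fin by (intro less.hyps) (auto intro: psubset_card_mono)
  qed
  finally show ?case
    using partial_orders fin less.prems top
    unfolding moebius.simps[of M "h v"] moebius.simps[of L v]
    by (simp add: carrier_push top_push inj_on_eq_iff[OF inj])
qed

text \<open>Pulling back all leaf labels commutes with taking states. Containment in the carrier
  belongs to the induction because \<open>h\<close> is injective only there, which the inclusion and
  the difference at a \<open>Minus\<close> node require.\<close>

lemma da_tree_pull:
  assumes "is_da_tree M t"
  defines "g \<equiv> inv_into (carrier L) h"
  shows "is_da_tree L (map_da_tree g t) \<and> da_state L (map_da_tree g t) \<subseteq> carrier L \<and>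
         da_state M t = h ` da_state L (map_da_tree g t)"
  using assms(1)
proof (induction t)
  case (Leaf v)
  then obtain x where x: "x \<in> carrier L" "v = h x"
    by (auto simp: carrier_push)
  then have "g v = x"
    using inj by (simp add: g_def)
  moreover have "\<top>\<^bsub>L\<^esub> \<in> carrier L"
    using fin_lattice_top[OF L] by (auto simp: greatest_def)
  ultimately show ?case
    using Leaf x
    by (auto simp: moebius_push top_push down_set_def carrier_push le_push inj_on_eq_iff[OF inj])
next
  case (Plus t1 t2)
  then show ?case
    by (auto simp: image_Un inj_on_image_Int[OF inj, symmetric])
next
  case (Minus t1 t2)
  let ?X = "\<lambda>t. da_state L (map_da_tree g t)"
  have sub: "?X t1 \<subseteq> carrier L" "?X t2 \<subseteq> carrier L"
    and states: "da_state M t1 = h ` ?X t1" "da_state M t2 = h ` ?X t2"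
    using Minus by auto
  have img: "h ` ?X t2 \<subseteq> h ` ?X t1"
    using Minus.prems states by simp
  have "?X t2 \<subseteq> ?X t1"
  proof
    fix x assume x: "x \<in> ?X t2"
    then obtain y where "y \<in> ?X t1" "h x = h y"
      using img by blast
    then show "x \<in> ?X t1"
      using inj_onD[OF inj, of x y] x sub by blast
  qed
  moreover have "h ` ?X t1 - h ` ?X t2 = h ` (?X t1 - ?X t2)"
    using inj_on_image_set_diff[OF inj] sub by blast
  ultimately show ?case
    using Minus by auto
qed simp

lemma winning_pull:
  assumes "winning M t"
  shows "\<exists>t. winning L t"
proof -
  let ?t = "map_da_tree (inv_into (carrier L) h) t"
  have t: "is_da_tree L ?t" "da_state L ?t \<subseteq> carrier L" "da_state M t = h ` da_state L ?t"
    using da_tree_pull[of t] assms by (auto simp: winning_def)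
  have "\<top>\<^bsub>L\<^esub> \<in> carrier L"
    using fin_lattice_top[OF L] by (auto simp: greatest_def)
  then have "h ` da_state L ?t = h ` (carrier L - {\<top>\<^bsub>L\<^esub>})"
    using t assms
    by (simp add: winning_def carrier_push top_push inj_on_image_set_diff[OF inj])
  then have "da_state L ?t = carrier L - {\<top>\<^bsub>L\<^esub>}"
    using inj_on_image_eq_iff[OF inj t(2), of "carrier L - {\<top>\<^bsub>L\<^esub>}"] by simp
  then show ?thesis
    using t(1) winning_def by blast
qed

end

text \<open>The conjecture ranges over lattices on natural numbers; a finite lattice on any type is
  copied there by an injection, and a winning tree is pulled back.\<close>

lemma NCI_conjecture_imp_winning:
  fixes L :: "('a, 'b) gorder_scheme"
  assumes NCI_conjecture "fin_lattice L"
  shows "\<exists>t. winning L t"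
proof -
  obtain h :: "'a \<Rightarrow> nat" where h: "inj_on h (carrier L)"
    using assms finite_imp_inj_to_nat_seg unfolding fin_lattice_def by blast
  then have "fin_lattice (push_order h L)"
    by (rule fin_lattice_push[OF assms(2)])
  then obtain t where "winning (push_order h L) t"
    using assms(1) by (auto simp: NCI_conjecture_def)
  then show ?thesis
    by (rule winning_pull[OF assms(2) h])
qed

section \<open>The affine plane\<close>

lemma plane_eq: "plane p = {0..<int p} \<times> {0..<int p}"
  by (auto simp: plane_def residue_ring_def)

lemma finite_plane [simp]: "finite (plane p)"
  by (simp add: plane_eq)

lemma card_plane: "card (plane p) = p\<^sup>2"
  by (simp add: plane_eq power2_eq_square)

definition slope_line :: "nat \<Rightarrow> int \<Rightarrow> int \<Rightarrow> point set" where
  "slope_line p s t = (\<lambda>x. (x, (s * x + t) mod int p)) ` {0..<int p}"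

text \<open>The non-vertical lines. For prime \<open>p\<close> there are exactly
  \<open>p\<^sup>2\<close> of them with exactly \<open>p\<close> through each point, which keeps the
  moment computations below exact.\<close>

definition slope_lines :: "nat \<Rightarrow> point set set" where
  "slope_lines p = (\<Union>s\<in>{0..<int p}. slope_line p s ` {0..<int p})"

lemma card_slope_line: "card (slope_line p s t) = p"
  by (simp add: slope_line_def card_image inj_on_def)

lemma affine_lines_eq:
  "affine_lines p = {{(x, y). (x, y) \<in> plane p \<and> [a * x + b * y = c] (mod int p)} | a b c.
     a \<in> {0..<int p} \<and> b \<in> {0..<int p} \<and> c \<in> {0..<int p} \<and> (a, b) \<noteq> (0, 0)}"
proof -
  have "(a * x mod int p + b * y mod int p) mod int p = c \<longleftrightarrow> [a * x + b * y = c] (mod int p)"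
    if "c \<in> {0..<int p}" for a b c x y
    using that by (simp add: cong_def mod_add_eq)
  moreover have "{0..int p - 1} = {0..<int p}"
    by auto
  ultimately show ?thesis
    by (simp add: affine_lines_def Let_def residue_ring_def cong: rev_conj_cong)
qed

lemma affine_line_subset: "l \<in> affine_lines p \<Longrightarrow> l \<subseteq> plane p"
  by (auto simp: affine_lines_eq)

lemma finite_affine_lines: "finite (affine_lines p)"
  by (rule finite_subset[of _ "Pow (plane p)"]) (auto dest: affine_line_subset)

lemma finite_affine_line: "l \<in> affine_lines p \<Longrightarrow> finite l"
  by (rule finite_subset[OF affine_line_subset finite_plane])

lemma slope_line_cong:
  assumes "[s = s'] (mod int p)" "[t = t'] (mod int p)"
  shows "slope_line p s t = slope_line p s' t'"
proof -
  have "[s * x + t = s' * x + t'] (mod int p)" for x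
    using assms by (intro cong_add cong_mult cong_refl)
  then show ?thesis
    by (simp add: slope_line_def cong_def)
qed

lemma slope_line_intercept:
  "(x, y) \<in> slope_line p s t \<Longrightarrow> [t = y - s * x] (mod int p)"
  by (auto simp: slope_line_def cong_def mod_diff_left_eq)

lemma finite_slope_lines: "finite (slope_lines p)"
  by (simp add: slope_lines_def)

lemma cong_mult_inverse_iff:
  fixes a b c d m :: int
  assumes "[a * b = 1] (mod m)"
  shows "[a * c = d] (mod m) \<longleftrightarrow> [c = b * d] (mod m)"
proof
  assume "[a * c = d] (mod m)"
  then have "[b * (a * c) = b * d] (mod m)"
    by (rule cong_scalar_left)
  moreover have "[a * b * c = 1 * c] (mod m)"
    using assms by (rule cong_scalar_right)
  ultimately show "[c = b * d] (mod m)"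
    by (metis cong_sym cong_trans mult.assoc mult.commute mult_1)
next
  assume "[c = b * d] (mod m)"
  then have "[a * c = a * (b * d)] (mod m)"
    by (rule cong_scalar_left)
  moreover have "[a * b * d = 1 * d] (mod m)"
    using assms by (rule cong_scalar_right)
  ultimately show "[a * c = d] (mod m)"
    by (metis cong_trans mult.assoc mult_1)
qed

context
  fixes p :: nat
  assumes prime: "prime p"
begin

lemma exists_inverse_mod:
  fixes a :: int
  assumes "a \<in> {0..<int p}" "a \<noteq> 0"
  obtains b where "[a * b = 1] (mod int p)"
proof -
  have "\<not> int p dvd a"
    using assms zdvd_imp_le by fastforce
  then have "coprime a (int p)"
    using prime prime_imp_coprime[of "int p" a] by (simp add: coprime_commute)
  then show ?thesis
    using cong_solve_coprime_int that by blast
qed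

text \<open>Solve \<open>a * x + b * y = c\<close> for \<open>y\<close> if \<open>b\<close> is
  invertible, otherwise for \<open>x\<close>. Slope and intercept need not be reduced modulo
  \<open>p\<close>.\<close>

lemma affine_line_cases:
  assumes "l \<in> affine_lines p"
  obtains (slope) s t where "l = slope_line p s t"
    | (vertical) c where "c \<in> {0..<int p}" "l = {c} \<times> {0..<int p}"
proof -
  obtain a b c where l: "l = {(x, y). (x, y) \<in> plane p \<and> [a * x + b * y = c] (mod int p)}"
    and abc: "a \<in> {0..<int p}" "b \<in> {0..<int p}" "(a, b) \<noteq> (0, 0)"
    using assms by (auto simp: affine_lines_eq)
  show thesis
  proof (cases "b = 0")
    case True
    then obtain a' where a': "[a * a' = 1] (mod int p)"
      using exists_inverse_mod abc by auto
    have "[a * x + b * y = c] (mod int p) \<longleftrightarrow> x = (a' * c) mod int p" if "x \<in> {0..<int p}" for x y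
      using cong_mult_inverse_iff[OF a', of x c] that by (simp add: True cong_def)
    then have "l = {(a' * c) mod int p} \<times> {0..<int p}"
      unfolding l plane_eq using prime_gt_0_nat[OF prime] by auto
    then show thesis
      using vertical[of "(a' * c) mod int p"] prime_gt_0_nat[OF prime] by simp
  next
    case False
    then obtain b' where b': "[b * b' = 1] (mod int p)"
      using exists_inverse_mod abc by auto
    have "[a * x + b * y = c] (mod int p) \<longleftrightarrow> [y = (- b' * a) * x + b' * c] (mod int p)" for x y
    proof -
      have "[a * x + b * y = c] (mod int p) \<longleftrightarrow> [b * y = c - a * x] (mod int p)"
        by (simp add: cong_iff_dvd_diff algebra_simps)
      also have "\<dots> \<longleftrightarrow> [y = b' * (c - a * x)] (mod int p)"
        by (rule cong_mult_inverse_iff[OF b'])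
      finally show ?thesis
        by (simp add: algebra_simps)
    qed
    then have "l = slope_line p (- b' * a) (b' * c)"
      unfolding l plane_eq slope_line_def
      using prime_gt_0_nat[OF prime] by (auto simp: cong_def)
    then show thesis
      by (rule slope)
  qed
qed

lemma card_affine_line: "l \<in> affine_lines p \<Longrightarrow> card l = p"
  by (erule affine_line_cases) (simp_all add: card_slope_line card_cartesian_product)

text \<open>Distinct points of a sloped line have distinct first coordinates, which excludes a
  vertical second line. For two sloped lines, subtracting the equations at both points gives a
  product divisible by \<open>p\<close>, hence congruent slopes and then congruent
  intercepts.\<close>

lemma affine_line_unique:
  assumes "l \<in> affine_lines p" "l' \<in> affine_lines p" "q \<noteq> q'"
    and "q \<in> l" "q' \<in> l" "q \<in> l'" "q' \<in> l'"
  shows "l = l'"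
proof -
  obtain x y x' y' where q: "q = (x, y)" "q' = (x', y')"
    by fastforce
  show ?thesis
    using assms(1)
  proof (cases rule: affine_line_cases)
    case l: (slope s t)
    have xx: "x \<noteq> x'"
      using assms l by (auto simp: q slope_line_def)
    from assms(2) show ?thesis
    proof (cases rule: affine_line_cases)
      case l': (slope s' t')
      have st: "[t = y - s * x] (mod int p)" "[t = y' - s * x'] (mod int p)"
        "[t' = y - s' * x] (mod int p)" "[t' = y' - s' * x'] (mod int p)"
        using assms slope_line_intercept by (auto simp: q l l')
      have "[y - s * x = y' - s * x'] (mod int p)" "[y - s' * x = y' - s' * x'] (mod int p)"
        using st by (meson cong_sym cong_trans)+
      from cong_diff[OF this] have "int p dvd (s' - s) * (x - x')"
        by (simp add: cong_iff_dvd_diff algebra_simps)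
      moreover have "x \<in> {0..<int p}" "x' \<in> {0..<int p}"
        using assms l by (auto simp: q slope_line_def)
      then have "\<not> int p dvd x - x'"
        using xx by (metis atLeastLessThan_iff cong_iff_dvd_diff cong_less_imp_eq_int)
      ultimately have "int p dvd s' - s"
        using prime prime_dvd_mult_iff[of "int p"] by auto
      then have s: "[s = s'] (mod int p)"
        by (simp add: cong_iff_dvd_diff dvd_diff_commute)
      have "[y - s * x = y - s' * x] (mod int p)"
        using s by (intro cong_diff cong_mult cong_refl)
      then have "[t = t'] (mod int p)"
        using st by (meson cong_sym cong_trans)
      then show ?thesis
        using s slope_line_cong by (simp add: l l')
    next
      case (vertical c)
      then show ?thesis
        using assms xx by (auto simp: q)
    qed
  next
    case l: (vertical c)
    from assms(2) show ?thesis
    proof (cases rule: affine_line_cases)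
      case (slope s t)
      then show ?thesis
        using assms l by (auto simp: q slope_line_def)
    next
      case (vertical c)
      then show ?thesis
        using assms l by (auto simp: q)
    qed
  qed
qed

lemma slope_lines_subset: "slope_lines p \<subseteq> affine_lines p"
proof
  fix l assume "l \<in> slope_lines p"
  then obtain s t where st: "s \<in> {0..<int p}" "t \<in> {0..<int p}" "l = slope_line p s t"
    by (auto simp: slope_lines_def)
  have "1 < int p"
    using prime_gt_1_nat[OF prime] by simp
  moreover have "[((- s) mod int p) * x + 1 * y = t] (mod int p) \<longleftrightarrow> [y = s * x + t] (mod int p)" for x y
  proof -
    have "[((- s) mod int p) * x + 1 * y = - s * x + 1 * y] (mod int p)"
      by (intro cong_add cong_mult cong_refl) (simp add: cong_def)
    then have "[((- s) mod int p) * x + 1 * y = t] (mod int p) \<longleftrightarrow> [- s * x + 1 * y = t] (mod int p)"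
      by (meson cong_sym cong_trans)
    also have "\<dots> \<longleftrightarrow> [y = s * x + t] (mod int p)"
      by (simp add: cong_iff_dvd_diff algebra_simps)
    finally show ?thesis .
  qed
  then have "l = {(x, y). (x, y) \<in> plane p \<and> [((- s) mod int p) * x + 1 * y = t] (mod int p)}"
    using \<open>1 < int p\<close> by (auto simp: st(3) slope_line_def plane_eq cong_def)
  ultimately show "l \<in> affine_lines p"
    unfolding affine_lines_eq using st
    by (intro CollectI exI[of _ "(- s) mod int p"] exI[of _ 1] exI[of _ t]) auto
qed

text \<open>A slope together with the point determines the intercept, so the lines through
  \<open>q\<close> are parametrized by their slopes.\<close>

lemma card_slope_lines_through:
  assumes "q \<in> plane p"
  shows "card {l \<in> slope_lines p. q \<in> l} = p"
proof -
  obtain x y where q: "q = (x, y)" "x \<in> {0..<int p}" "y \<in> {0..<int p}"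
    using assms by (auto simp: plane_eq)
  have p: "1 < int p"
    using prime_gt_1_nat[OF prime] by simp
  define f where "f s = slope_line p s ((y - s * x) mod int p)" for s
  have q_in: "q \<in> f s" for s
    using q by (force simp: f_def slope_line_def mod_simps)
  have "{l \<in> slope_lines p. q \<in> l} = f ` {0..<int p}"
  proof (intro equalityI subsetI)
    fix l assume "l \<in> {l \<in> slope_lines p. q \<in> l}"
    then obtain s t where st: "s \<in> {0..<int p}" "t \<in> {0..<int p}" "l = slope_line p s t" "q \<in> l"
      by (auto simp: slope_lines_def)
    then have "t = (y - s * x) mod int p"
      using slope_line_intercept[of x y p s t] by (simp add: q cong_def)
    then show "l \<in> f ` {0..<int p}"
      using st by (simp add: f_def)
  next
    fix l assume "l \<in> f ` {0..<int p}"
    then show "l \<in> {l \<in> slope_lines p. q \<in> l}"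
      using q_in p by (fastforce simp: f_def slope_lines_def)
  qed
  moreover have "inj_on f {0..<int p}"
  proof (rule inj_onI)
    fix s s' assume s: "s \<in> {0..<int p}" "s' \<in> {0..<int p}" and f: "f s = f s'"
    \<comment> \<open>One step to the right of \<open>q\<close> the two lines differ by
      \<open>s - s'\<close>, so this coordinate separates slopes.\<close>
    define x' where "x' = (x + 1) mod int p"
    have "x' \<in> {0..<int p}"
      using p by (simp add: x'_def)
    then have "(x', (s * x' + (y - s * x)) mod int p) \<in> f s"
      by (force simp: f_def slope_line_def mod_simps)
    then have "[s * x' + (y - s * x) = s' * x' + (y - s' * x)] (mod int p)"
      unfolding f by (auto simp: f_def slope_line_def mod_simps cong_def)
    then have "int p dvd (s - s') * (x' - x)"
      by (simp add: cong_iff_dvd_diff algebra_simps)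
    moreover have "[x' - x = 1] (mod int p)"
      by (simp add: x'_def cong_def mod_simps)
    ultimately have "[s = s'] (mod int p)"
      by (metis cong_0_iff cong_iff_dvd_diff cong_scalar_left cong_sym cong_trans mult.right_neutral)
    then show "s = s'"
      using s by (simp add: cong_def)
  qed
  ultimately show ?thesis
    by (simp add: card_image)
qed

text \<open>Double counting of incidences: \<open>p\<close> points on each line, \<open>p\<close>
  lines through each of the \<open>p\<^sup>2\<close> points.\<close>

lemma card_slope_lines: "card (slope_lines p) = p\<^sup>2"
proof -
  have "(\<Sum>l\<in>slope_lines p. card l) = (\<Sum>l\<in>slope_lines p. card {q \<in> plane p. q \<in> l})"
    using slope_lines_subset affine_line_subset
    by (intro sum.cong refl arg_cong[of _ _ card]) blast
  also have "\<dots> = p * card (plane p)"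
    using card_slope_lines_through
    by (intro sum_multicount) (auto simp: finite_slope_lines)
  also have "(\<Sum>l\<in>slope_lines p. card l) = card (slope_lines p) * p"
    using slope_lines_subset card_affine_line by (simp add: subset_iff)
  finally show ?thesis
    using prime_gt_0_nat[OF prime] by (simp add: card_plane)
qed

end

section \<open>Counting\<close>

lemma card_Int_eq_sum:
  assumes "finite T"
  shows "real (card (T \<inter> l)) = (\<Sum>q\<in>T. of_bool (q \<in> l))"
  using assms by (simp add: Int_def)

lemma sum_of_bool_eq_card:
  "finite F \<Longrightarrow> (\<Sum>l\<in>F. of_bool (P l)) = real (card {l \<in> F. P l})"
  by (simp add: Int_def)

text \<open>The second moment counts triples of a line and two points of \<open>T\<close> on it. A
  diagonal pair lies on \<open>p\<close> lines, any other pair on at most one.\<close>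

lemma sum_square_incidences_le:
  assumes "finite T" "finite F"
    and through: "\<And>q. q \<in> T \<Longrightarrow> card {l \<in> F. q \<in> l} = p"
    and unique: "\<And>q q'. q \<in> T \<Longrightarrow> q' \<in> T \<Longrightarrow> q \<noteq> q' \<Longrightarrow> card {l \<in> F. q \<in> l \<and> q' \<in> l} \<le> 1"
  shows "(\<Sum>l\<in>F. (real (card (T \<inter> l)))\<^sup>2) \<le> real (card T) * p + (real (card T))\<^sup>2"
proof -
  have "(\<Sum>l\<in>F. (real (card (T \<inter> l)))\<^sup>2) =
        (\<Sum>l\<in>F. \<Sum>q\<in>T. \<Sum>q'\<in>T. of_bool (q \<in> l \<and> q' \<in> l))"
    by (simp add: card_Int_eq_sum[OF assms(1)] power2_eq_square sum_product of_bool_conj)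
  also have "\<dots> = (\<Sum>q\<in>T. \<Sum>q'\<in>T. \<Sum>l\<in>F. of_bool (q \<in> l \<and> q' \<in> l))"
    by (subst sum.swap, rule sum.cong[OF refl], subst sum.swap, rule refl)
  also have "\<dots> = (\<Sum>q\<in>T. \<Sum>q'\<in>T. real (card {l \<in> F. q \<in> l \<and> q' \<in> l}))"
    by (simp only: sum_of_bool_eq_card[OF assms(2)])
  \<comment> \<open>The extra 1 is granted to diagonal pairs as well, which gives the square of
    \<open>card T\<close> as second term.\<close>
  also have "\<dots> \<le> (\<Sum>q\<in>T. \<Sum>q'\<in>T. (if q' = q then real p else 0) + 1)"
  proof (intro sum_mono)
    fix q q' assume "q \<in> T" "q' \<in> T"
    then show "real (card {l \<in> F. q \<in> l \<and> q' \<in> l}) \<le> (if q' = q then real p else 0) + 1"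
      using through[of q] unique[of q q'] by (cases "q' = q") auto
  qed
  also have "\<dots> = real (card T) * p + (real (card T))\<^sup>2"
    using assms(1) by (simp add: sum.distrib power2_eq_square algebra_simps)
  finally show ?thesis .
qed

lemma sum_incidences:
  assumes "finite T" "finite F" "\<And>q. q \<in> T \<Longrightarrow> card {l \<in> F. q \<in> l} = p"
  shows "(\<Sum>l\<in>F. real (card (T \<inter> l))) = real (card T) * p"
proof -
  have "(\<Sum>l\<in>F. real (card (T \<inter> l))) = (\<Sum>q\<in>T. \<Sum>l\<in>F. of_bool (q \<in> l))"
    by (simp only: card_Int_eq_sum[OF assms(1)]) (rule sum.swap)
  also have "\<dots> = (\<Sum>q\<in>T. real p)"
    using assms(3) by (intro sum.cong refl) (simp only: sum_of_bool_eq_card[OF assms(2)])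
  finally show ?thesis
    by simp
qed

text \<open>Chebyshev's inequality for the number of points of \<open>T\<close> on a random line of \<open>F\<close>.\<close>

lemma card_medium_lines:
  fixes T :: "'a set" and F :: "'a set set" and p :: nat
  assumes fin: "finite T" "finite F" and p: "p > 0" and F: "card F = p\<^sup>2"
    and through: "\<And>q. q \<in> T \<Longrightarrow> card {l \<in> F. q \<in> l} = p"
    and unique: "\<And>q q'. q \<in> T \<Longrightarrow> q' \<in> T \<Longrightarrow> q \<noteq> q' \<Longrightarrow> card {l \<in> F. q \<in> l \<and> q' \<in> l} \<le> 1"
    and T: "4 * p \<le> card T" "card T < 8 * p"
  shows "p\<^sup>2 \<le> 2 * card {l \<in> F. card (T \<inter> l) \<in> {2..16}}"
proof -
  define k where "k l = real (card (T \<inter> l))" for l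
  \<comment> \<open>The mean of \<open>k\<close>: there are \<open>card T * p\<close> incidences on
    \<open>p\<^sup>2\<close> lines.\<close>
  define \<mu> where "\<mu> = card T / real p"
  define G where "G = {l \<in> F. card (T \<inter> l) \<in> {2..16}}"
  have card_A: "real (card T) = \<mu> * p"
    using p by (simp add: \<mu>_def)
  have \<mu>: "4 \<le> \<mu>" "\<mu> < 8"
    using p T by (simp_all add: \<mu>_def field_simps)
  have "(\<Sum>l\<in>F. (k l - \<mu>)\<^sup>2) = (\<Sum>l\<in>F. (k l)\<^sup>2) - 2 * \<mu> * (\<Sum>l\<in>F. k l) + real (card F) * \<mu>\<^sup>2"
    by (simp add: power2_diff sum.distrib sum_subtractf sum_distrib_left sum_distrib_right mult_ac)
  also have "\<dots> \<le> real (card T) * p + (real (card T))\<^sup>2 - 2 * \<mu> * (real (card T) * p) + real (card F) * \<mu>\<^sup>2"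
    using sum_square_incidences_le[OF fin through unique] sum_incidences[OF fin through]
    by (simp add: k_def)
  also have "\<dots> = \<mu> * (real p)\<^sup>2"
    unfolding card_A F by (simp add: power2_eq_square algebra_simps)
  finally have var: "(\<Sum>l\<in>F. (k l - \<mu>)\<^sup>2) \<le> \<mu> * (real p)\<^sup>2" .
  have "real (card (F - G)) * (2 * \<mu>) = (\<Sum>l\<in>F - G. 2 * \<mu>)"
    by simp
  also have "\<dots> \<le> (\<Sum>l\<in>F - G. (k l - \<mu>)\<^sup>2)"
  proof (rule sum_mono)
    fix l assume "l \<in> F - G"
    \<comment> \<open>Since \<mu> lies between 4 and 8, both 1 and 16 are at distance at least
      \<open>\<mu> - 1\<close> from it. The lower bound 4 makes the square of
      \<open>\<mu> - 1\<close> at least \<open>2 * \<mu>\<close>, so by the variance bound at most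
      half of the lines are bad.\<close>
    then have "k l \<le> 1 \<or> 16 \<le> k l"
      by (auto simp: G_def k_def)
    then have "\<mu> - 1 \<le> \<bar>k l - \<mu>\<bar>"
      using \<mu> by auto
    then have "(\<mu> - 1)\<^sup>2 \<le> \<bar>k l - \<mu>\<bar>\<^sup>2"
      using \<mu> by (intro power_mono) auto
    moreover have "0 \<le> \<mu> * (\<mu> - 4)"
      using \<mu> by simp
    ultimately show "2 * \<mu> \<le> (k l - \<mu>)\<^sup>2"
      by (simp add: power2_eq_square algebra_simps)
  qed
  also have "\<dots> \<le> (\<Sum>l\<in>F. (k l - \<mu>)\<^sup>2)"
    using fin by (intro sum_mono2) auto
  finally have "\<mu> * (2 * real (card (F - G))) \<le> \<mu> * (real p)\<^sup>2"
    using var by (simp add: mult_ac)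
  then have "2 * real (card (F - G)) \<le> (real p)\<^sup>2"
    using \<mu> by simp
  then have "2 * card (F - G) \<le> p\<^sup>2"
    by (simp flip: of_nat_power of_nat_le_iff[where 'a = real])
  moreover have "card F = card (F - G) + card G"
    using fin card_mono[of F G] by (subst card_Diff_subset) (auto simp: G_def)
  ultimately show ?thesis
    using F by (simp add: G_def)
qed

section \<open>Counting subsets and choice functions\<close>

definition subsets_of_card :: "'a set \<Rightarrow> nat \<Rightarrow> 'a set set" where
  "subsets_of_card l w = {S. S \<subseteq> l \<and> card S = w}"

lemma finite_subsets_of_card: "finite l \<Longrightarrow> finite (subsets_of_card l w)"
  by (rule finite_subset[of _ "Pow l"]) (auto simp: subsets_of_card_def)

lemma card_subsets_of_card: "finite l \<Longrightarrow> card (subsets_of_card l w) = card l choose w"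
  by (simp add: subsets_of_card_def n_subsets)

text \<open>Union bound over the points of \<open>K\<close>: each lies in a fraction
  \<open>w / card l\<close> of the \<open>w\<close>-subsets of \<open>l\<close>, by the absorption
  identity for binomial coefficients.\<close>

lemma card_subsets_hitting_le:
  assumes "finite l" "K \<subseteq> l" "0 < w" "2 * (card K * w) \<le> card l"
  shows "2 * card {S \<in> subsets_of_card l w. K \<inter> S \<noteq> {}} \<le> card l choose w"
proof (cases "K = {}")
  case False
  have finK: "finite K"
    using assms finite_subset by blast
  have l: "card l > 0"
    using False assms finite_subset by (auto simp: card_gt_0_iff)
  have one: "card {S \<in> subsets_of_card l w. q \<in> S} \<le> (card l - 1) choose (w - 1)" if "q \<in> K" for q
  proof -
    have "inj_on (\<lambda>S. S - {q}) {S \<in> subsets_of_card l w. q \<in> S}"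
      by (auto simp: inj_on_def)
    moreover have "(\<lambda>S. S - {q}) ` {S \<in> subsets_of_card l w. q \<in> S} \<subseteq> subsets_of_card (l - {q}) (w - 1)"
      by (auto simp: subsets_of_card_def)
    ultimately have "card {S \<in> subsets_of_card l w. q \<in> S} \<le> card (subsets_of_card (l - {q}) (w - 1))"
      using assms(1) by (intro card_inj_on_le finite_subsets_of_card) auto
    then show ?thesis
      using that assms(1,2) by (simp add: card_subsets_of_card subset_iff)
  qed
  have "{S \<in> subsets_of_card l w. K \<inter> S \<noteq> {}} = (\<Union>q\<in>K. {S \<in> subsets_of_card l w. q \<in> S})"
    by auto
  then have "card {S \<in> subsets_of_card l w. K \<inter> S \<noteq> {}} \<le> (\<Sum>q\<in>K. card {S \<in> subsets_of_card l w. q \<in> S})"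
    using card_UN_le[OF finK] by simp
  also have "\<dots> \<le> card K * ((card l - 1) choose (w - 1))"
    using sum_mono[OF one] by simp
  finally have "card l * (2 * card {S \<in> subsets_of_card l w. K \<inter> S \<noteq> {}}) \<le>
      2 * card K * (card l * ((card l - 1) choose (w - 1)))"
    by (simp add: mult.left_commute)
  also have "card l * ((card l - 1) choose (w - 1)) = w * (card l choose w)"
    using times_binomial_minus1_eq[OF assms(3)] by simp
  also have "2 * card K * (w * (card l choose w)) = 2 * (card K * w) * (card l choose w)"
    by simp
  also have "\<dots> \<le> card l * (card l choose w)"
    using assms(4) by (rule mult_right_mono) simp
  finally show ?thesis
    using l by simp
qed simp

text \<open>Independence in counting form: cardinalities of products multiply, and every coordinate
  in \<open>J\<close> contributes a factor of at most one half.\<close>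

lemma card_PiE_half_le:
  fixes X Y :: "'i \<Rightarrow> 'b set"
  assumes "finite I" "J \<subseteq> I"
    and "\<And>i. i \<in> J \<Longrightarrow> 2 * card (Y i) \<le> card (X i)"
    and "\<And>i. i \<in> I - J \<Longrightarrow> card (Y i) \<le> card (X i)"
  shows "2 ^ card J * card (\<Pi>\<^sub>E i\<in>I. Y i) \<le> card (\<Pi>\<^sub>E i\<in>I. X i)"
proof -
  have finJ: "finite J"
    using assms finite_subset by blast
  have split: "(\<Prod>i\<in>I. f i) = (\<Prod>i\<in>I - J. f i) * (\<Prod>i\<in>J. f i)" for f :: "'i \<Rightarrow> nat"
    by (rule prod.subset_diff[OF assms(2,1)])
  have "2 ^ card J * card (\<Pi>\<^sub>E i\<in>I. Y i) = (\<Prod>i\<in>I - J. card (Y i)) * (\<Prod>i\<in>J. 2 * card (Y i))"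
    by (simp add: card_PiE[OF assms(1)] split prod.distrib)
  also have "\<dots> \<le> (\<Prod>i\<in>I - J. card (X i)) * (\<Prod>i\<in>J. card (X i))"
    using assms(3,4) by (intro mult_mono prod_mono) auto
  also have "\<dots> = card (\<Pi>\<^sub>E i\<in>I. X i)"
    by (simp add: card_PiE[OF assms(1)] split)
  finally show ?thesis .
qed

text \<open>Each such \<open>T\<close> is the set of entries of a list of length exactly
  \<open>n\<close>: enumerate it and pad with one of its own elements, which exists as
  \<open>T\<close> is nonempty.\<close>

lemma card_bounded_subsets_le:
  assumes "finite U"
  shows "finite {T. T \<subseteq> U \<and> T \<noteq> {} \<and> card T \<le> n}"
    and "card {T. T \<subseteq> U \<and> T \<noteq> {} \<and> card T \<le> n} \<le> card U ^ n"
proof -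
  have sub: "{T. T \<subseteq> U \<and> T \<noteq> {} \<and> card T \<le> n} \<subseteq> set ` {xs. set xs \<subseteq> U \<and> length xs = n}"
  proof
    fix T assume "T \<in> {T. T \<subseteq> U \<and> T \<noteq> {} \<and> card T \<le> n}"
    then have T: "T \<subseteq> U" "T \<noteq> {}" "card T \<le> n"
      by auto
    then obtain xs a where xs: "set xs = T" "distinct xs" "a \<in> T"
      using assms finite_subset finite_distinct_list by blast
    then have "T = set (xs @ replicate (n - card T) a)" "length (xs @ replicate (n - card T) a) = n"
      using T by (auto simp: distinct_card set_replicate_conv_if)
    then show "T \<in> set ` {xs. set xs \<subseteq> U \<and> length xs = n}"
      using T by blast
  qed
  show "finite {T. T \<subseteq> U \<and> T \<noteq> {} \<and> card T \<le> n}"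
    using assms by (intro finite_subset[OF _ finite_Pow_iff[THEN iffD2, OF assms]]) auto
  have "card {T. T \<subseteq> U \<and> T \<noteq> {} \<and> card T \<le> n} \<le> card {xs. set xs \<subseteq> U \<and> length xs = n}"
    using sub by (rule surj_card_le[OF finite_lists_length_eq[OF assms]])
  then show "card {T. T \<subseteq> U \<and> T \<noteq> {} \<and> card T \<le> n} \<le> card U ^ n"
    by (simp add: card_lists_length_eq[OF assms])
qed

text \<open>With \<open>k = p div 64\<close> one has \<open>p < 2 ^ (k + 6)\<close>, and
  \<open>32 * (k + 6) \<le> p\<close> because \<open>32 * k\<close> and 192 are both at most half of
  \<open>p\<close>; the latter is where 384 comes from.\<close>

lemma power_32_less_two_power:
  fixes p :: nat
  assumes "384 \<le> p"
  shows "p ^ 32 < 2 ^ p"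
proof -
  define k where "k = p div 64"
  have "p < 64 * (k + 1)"
    by (simp add: k_def)
  also have "k + 1 \<le> 2 ^ k"
    using less_exp[of k] by (simp add: Suc_le_eq)
  also have "64 * 2 ^ k = (2 :: nat) ^ (k + 6)"
    by (simp add: power_add)
  finally have "p ^ 32 < (2 ^ (k + 6)) ^ 32"
    by (intro power_strict_mono) auto
  also have "\<dots> \<le> 2 ^ p"
    using assms unfolding power_mult[symmetric]
    by (intro power_increasing) (auto simp: k_def)
  finally show ?thesis .
qed

section \<open>The lattice of a marking\<close>

text \<open>Represents an element by the points whose level-1 elements lie weakly above it. This
  turns the lattice into an intersection-closed family of point sets under reverse
  inclusion.\<close>

primrec points_above :: "nat \<Rightarrow> (point set \<Rightarrow> nat \<Rightarrow> point set) \<Rightarrow> elt \<Rightarrow> point set" where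
  "points_above p pr Top = {}"
| "points_above p pr (A q) = {q}"
| "points_above p pr (C l z) = pr l z"
| "points_above p pr (B l) = l"
| "points_above p pr Bot = plane p"

lemma carrier_P_lattice:
  "carrier (P_lattice p m pr) = {Top, Bot} \<union> A ` plane p
     \<union> {C l z | l z. l \<in> affine_lines p \<and> z \<in> {1..p - 1}} \<union> B ` affine_lines p"
  by (simp add: P_lattice_def)

lemma eq_P_lattice: "eq (P_lattice p m pr) = (=)"
  by (simp add: P_lattice_def)

lemma le_P_lattice: "x \<sqsubseteq>\<^bsub>P_lattice p m pr\<^esub> y \<longleftrightarrow> (covered p m pr)\<^sup>*\<^sup>* x y"
  by (simp add: P_lattice_def)

lemma sum_of_bool_eq: "finite S \<Longrightarrow> (\<Sum>x\<in>S. of_bool (a = x)) = (of_bool (a \<in> S) :: int)"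
  by (simp add: of_bool_def)

text \<open>For \<open>p > 2\<close> the sizes 0, 1, 2, \<open>p\<close> and
  \<open>p\<^sup>2\<close> of the representing point sets are distinct, so the size alone reveals
  the kind of an element.\<close>

locale nci_lattice =
  fixes p :: nat and m :: "point set \<Rightarrow> point set" and pr :: "point set \<Rightarrow> nat \<Rightarrow> point set"
  assumes prime: "prime p" and two_less: "2 < p"
    and marking: "marking p m" and pair_choice: "pair_choice p m pr"
begin

abbreviation "P \<equiv> P_lattice p m pr"
abbreviation "pts \<equiv> points_above p pr"

lemma marked_subset: "l \<in> affine_lines p \<Longrightarrow> m l \<subseteq> l"
  using marking by (simp add: marking_def)

lemma pair_subset_marked: "l \<in> affine_lines p \<Longrightarrow> z \<in> {1..p - 1} \<Longrightarrow> pr l z \<subseteq> m l"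
  using pair_choice by (simp add: pair_choice_def)

lemma pair_subset: "l \<in> affine_lines p \<Longrightarrow> z \<in> {1..p - 1} \<Longrightarrow> pr l z \<subseteq> l"
  using pair_subset_marked marked_subset by blast

lemma card_pair: "l \<in> affine_lines p \<Longrightarrow> z \<in> {1..p - 1} \<Longrightarrow> card (pr l z) = 2"
  using pair_choice by (simp add: pair_choice_def)

lemma marked_in_pair: "l \<in> affine_lines p \<Longrightarrow> q \<in> m l \<Longrightarrow> \<exists>z\<in>{1..p - 1}. q \<in> pr l z"
  using pair_choice unfolding pair_choice_def by blast

lemma pair_inj:
  "l \<in> affine_lines p \<Longrightarrow> z \<in> {1..p - 1} \<Longrightarrow> z' \<in> {1..p - 1} \<Longrightarrow> pr l z = pr l z' \<Longrightarrow> z = z'"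
  using pair_choice by (simp add: pair_choice_def inj_on_def)

lemmas line_subset = affine_line_subset
lemmas card_line = card_affine_line[OF prime]
lemmas line_unique = affine_line_unique[OF prime]
lemmas finite_line = finite_affine_line

lemma finite_pair: "l \<in> affine_lines p \<Longrightarrow> z \<in> {1..p - 1} \<Longrightarrow> finite (pr l z)"
  using card_pair by (metis card.infinite zero_neq_numeral)

lemma line_of_pair:
  assumes "l \<in> affine_lines p" "z \<in> {1..p - 1}" "l' \<in> affine_lines p" "pr l z \<subseteq> l'"
  shows "l = l'"
proof -
  obtain q q' where "pr l z = {q, q'}" "q \<noteq> q'"
    using card_pair[OF assms(1,2)] by (auto simp: card_2_iff)
  then show ?thesis
    using line_unique[OF assms(1,3), of q q'] pair_subset[OF assms(1,2)] assms(4) by auto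
qed

lemma pair_subset_pair:
  assumes "l \<in> affine_lines p" "z \<in> {1..p - 1}" "l' \<in> affine_lines p" "z' \<in> {1..p - 1}"
    and "pr l z \<subseteq> pr l' z'"
  shows "l = l' \<and> z = z'"
proof -
  have "l = l'"
    using line_of_pair[OF assms(1-3)] pair_subset[OF assms(3,4)] assms(5) by blast
  moreover have "pr l z = pr l' z'"
    using card_subset_eq[OF finite_pair[OF assms(3,4)] assms(5)] card_pair assms by simp
  ultimately show ?thesis
    using pair_inj assms by blast
qed

lemma line_through: "q \<in> plane p \<Longrightarrow> \<exists>l\<in>affine_lines p. q \<in> l"
  using card_slope_lines_through[OF prime] slope_lines_subset[OF prime] two_less
  by (metis (mono_tags, lifting) card.empty empty_Collect_eq not_less_zero subset_iff)

lemma card_line_less_plane: "p < p\<^sup>2"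
  using two_less by (simp add: power2_eq_square)

lemma carrier_cases [consumes 1, case_names Top A C B Bot]:
  assumes "x \<in> carrier P"
  obtains "x = Top" | q where "x = A q" "q \<in> plane p"
    | l z where "x = C l z" "l \<in> affine_lines p" "z \<in> {1..p - 1}"
    | l where "x = B l" "l \<in> affine_lines p" | "x = Bot"
  using assms by (auto simp: carrier_P_lattice)

lemma finite_above: "x \<in> carrier P \<Longrightarrow> finite (pts x)"
  by (cases x rule: carrier_cases) (auto simp: finite_pair finite_line)

lemma card_above:
  assumes "x \<in> carrier P"
  shows "card (pts x) = (case x of Top \<Rightarrow> 0 | A q \<Rightarrow> 1 | C l z \<Rightarrow> 2 | B l \<Rightarrow> p | Bot \<Rightarrow> p\<^sup>2)"
  using assms by (cases x rule: carrier_cases) (simp_all add: card_pair card_line card_plane)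

lemma above_subset_plane:
  assumes "x \<in> carrier P"
  shows "pts x \<subseteq> plane p"
  using assms
proof (cases x rule: carrier_cases)
  case (C l z)
  then show ?thesis
    using pair_subset[of l z] line_subset[of l] by auto
next
  case (B l)
  then show ?thesis
    using line_subset by simp
qed auto

lemma above_antimono: "(covered p m pr)\<^sup>*\<^sup>* x y \<Longrightarrow> pts y \<subseteq> pts x"
proof (induction rule: rtranclp_induct)
  case (step y z)
  have "pts z \<subseteq> pts y"
    using step(2) by cases (use pair_subset line_subset in auto)
  with step.IH show ?case
    by blast
qed simp

lemma cover_chains:
  shows "q \<in> plane p \<Longrightarrow> (covered p m pr)\<^sup>*\<^sup>* (A q) Top"
    and "l \<in> affine_lines p \<Longrightarrow> z \<in> {1..p - 1} \<Longrightarrow> q \<in> pr l z \<Longrightarrow> (covered p m pr)\<^sup>*\<^sup>* (C l z) (A q)"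
    and "l \<in> affine_lines p \<Longrightarrow> z \<in> {1..p - 1} \<Longrightarrow> (covered p m pr)\<^sup>*\<^sup>* (B l) (C l z)"
    and "l \<in> affine_lines p \<Longrightarrow> (covered p m pr)\<^sup>*\<^sup>* Bot (B l)"
  by (blast intro: covered.intros)+

text \<open>An unmarked point is a parent of \<open>B l\<close>; a marked one is reached through a
  level-2 element whose pair contains it.\<close>

lemma B_le_A:
  assumes "l \<in> affine_lines p" "q \<in> l"
  shows "(covered p m pr)\<^sup>*\<^sup>* (B l) (A q)"
proof (cases "q \<in> m l")
  case True
  then obtain z where "z \<in> {1..p - 1}" "q \<in> pr l z"
    using marked_in_pair assms by blast
  then show ?thesis
    using cover_chains(2,3) assms by (meson rtranclp_trans)
next
  case False
  then show ?thesis
    using assms by (auto intro: covered.intros)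
qed

lemma le_A:
  assumes "x \<in> carrier P" "q \<in> pts x"
  shows "(covered p m pr)\<^sup>*\<^sup>* x (A q)"
  using assms
proof (cases x rule: carrier_cases)
  case Bot
  then obtain l where "l \<in> affine_lines p" "q \<in> l"
    using assms(2) line_through[of q] by auto
  then show ?thesis
    using cover_chains(4) B_le_A Bot by (meson rtranclp_trans)
qed (use assms cover_chains B_le_A in auto)

text \<open>Covers enlarge the point set downwards, which is one direction. Conversely, sizes
  restrict the kinds of \<open>x\<close> possible for a given \<open>y\<close>, and two points
  determining a line fix the indices.\<close>

lemma le_iff_above:
  assumes x: "x \<in> carrier P" and y: "y \<in> carrier P"
  shows "x \<sqsubseteq>\<^bsub>P\<^esub> y \<longleftrightarrow> pts y \<subseteq> pts x"
proof
  assume sub: "pts y \<subseteq> pts x"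
  then have card: "card (pts y) \<le> card (pts x)"
    using finite_above[OF x] by (rule card_mono[rotated])
  have "(covered p m pr)\<^sup>*\<^sup>* x y"
    using y
  proof (cases y rule: carrier_cases)
    case Top
    show ?thesis
    proof (cases "x = Top")
      case False
      then have "card (pts x) \<noteq> 0"
        using card_above[OF x] two_less by (auto split: elt.splits)
      then have "pts x \<noteq> {}"
        by auto
      then obtain q where q: "q \<in> pts x"
        by blast
      then have "q \<in> plane p"
        using above_subset_plane[OF x] by blast
      then show ?thesis
        using le_A[OF x q] cover_chains(1) Top by (meson rtranclp_trans)
    qed (simp add: Top)
  next
    case (A q)
    then show ?thesis
      using le_A[OF x] sub by simp
  next
    case yC: (C l z)
    from x show ?thesis
    proof (cases x rule: carrier_cases)
      case (C l' z')
      then show ?thesis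
        using pair_subset_pair yC sub by auto
    next
      case (B l')
      then have "l = l'"
        using line_of_pair[OF yC(2,3) B(2)] yC sub by simp
      then show ?thesis
        using yC B cover_chains(3) by simp
    next
      case Bot
      then show ?thesis
        using yC cover_chains(3,4) by (meson rtranclp_trans)
    qed (use card card_above[OF x] card_above[OF y] yC in auto)
  next
    case yB: (B l)
    from x show ?thesis
    proof (cases x rule: carrier_cases)
      case (B l')
      then have "l = l'"
        using card_subset_eq[of l' l] yB sub finite_line card_line by auto
      then show ?thesis
        using B yB by simp
    next
      case Bot
      then show ?thesis
        using yB cover_chains(4) by auto
    qed (use card card_above[OF x] card_above[OF y] yB two_less in auto)
  next
    case Bot
    from x show ?thesis
      by (cases x rule: carrier_cases)
        (use card card_above[OF x] card_above[OF y] Bot two_less card_line_less_plane in auto)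
  qed
  then show "x \<sqsubseteq>\<^bsub>P\<^esub> y"
    by (simp add: le_P_lattice)
qed (simp add: le_P_lattice above_antimono)

lemma inj_on_above: "inj_on pts (carrier P)"
proof (rule inj_onI)
  fix x y assume x: "x \<in> carrier P" and y: "y \<in> carrier P" and eq: "pts x = pts y"
  have card: "card (pts x) = card (pts y)"
    using eq by simp
  show "x = y"
    using x
  proof (cases x rule: carrier_cases)
    case xC: (C l z)
    from y show ?thesis
      by (cases y rule: carrier_cases)
        (use xC card card_above[OF x] card_above[OF y] two_less card_line_less_plane eq pair_subset_pair in auto)
  qed (use y in \<open>cases y rule: carrier_cases;
      use card card_above[OF x] card_above[OF y] two_less card_line_less_plane eq in auto\<close>)+
qed

lemma partial_order_P: "partial_order P"
  using partial_order_of_embedding[OF eq_P_lattice inj_on_above] le_iff_above by blast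

lemma eq_B_or_C_of_two_points_above:
  assumes "x \<in> carrier P" "q \<noteq> q'" "q \<in> pts x" "q' \<in> pts x"
  shows "x = Bot \<or> (\<exists>l\<in>affine_lines p. q \<in> l \<and> q' \<in> l \<and>
           (x = B l \<or> (\<exists>z\<in>{1..p - 1}. x = C l z \<and> pr l z = {q, q'})))"
  using assms(1)
proof (cases x rule: carrier_cases)
  case (C l z)
  then have "{q, q'} = pr l z"
    using assms card_pair[of l z] by (intro card_subset_eq finite_pair) auto
  then show ?thesis
    using C pair_subset[of l z] by blast
qed (use assms in auto)

lemma above_inter_closed:
  assumes x: "x \<in> carrier P" and y: "y \<in> carrier P"
  shows "\<exists>z\<in>carrier P. pts z = pts x \<inter> pts y"
proof (cases "\<exists>q q'. q \<noteq> q' \<and> {q, q'} \<subseteq> pts x \<inter> pts y")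
  case True
  then obtain q q' where q: "q \<noteq> q'" "q \<in> pts x" "q' \<in> pts x" "q \<in> pts y" "q' \<in> pts y"
    by blast
  \<comment> \<open>Two common points determine the line, so both elements are the bottom, that
    line, or the pair itself; these are nested. With fewer common points the intersection represents
    \<open>Top\<close> or some \<open>A q\<close>.\<close>
  have "pts x \<subseteq> pts y \<or> pts y \<subseteq> pts x"
  proof (cases "x = Bot \<or> y = Bot")
    case False
    then obtain l l' where l: "l \<in> affine_lines p" "q \<in> l" "q' \<in> l"
        "x = B l \<or> (\<exists>z\<in>{1..p - 1}. x = C l z \<and> pr l z = {q, q'})"
      and l': "l' \<in> affine_lines p" "q \<in> l'" "q' \<in> l'"
        "y = B l' \<or> (\<exists>z\<in>{1..p - 1}. y = C l' z \<and> pr l' z = {q, q'})"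
      using eq_B_or_C_of_two_points_above[OF x q(1-3)] eq_B_or_C_of_two_points_above[OF y q(1,4,5)] by blast
    have "l = l'"
      using line_unique l l' q(1) by blast
    then show ?thesis
      using l l' by auto
  qed (use above_subset_plane[OF x] above_subset_plane[OF y] in auto)
  then show ?thesis
    using x y by (metis Int_absorb1 Int_absorb2)
next
  case False
  show ?thesis
  proof (cases "pts x \<inter> pts y = {}")
    case True
    then show ?thesis
      by (intro bexI[of _ Top]) (auto simp: carrier_P_lattice)
  next
    case ne: False
    then obtain q where q: "q \<in> pts x \<inter> pts y"
      by blast
    then have "pts x \<inter> pts y = {q}"
      using False by blast
    moreover have "q \<in> plane p"
      using q above_subset_plane[OF x] by blast
    ultimately show ?thesis
      by (intro bexI[of _ "A q"]) (auto simp: carrier_P_lattice)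
  qed
qed

lemma finite_carrier_P: "finite (carrier P)"
proof -
  have "{C l z | l z. l \<in> affine_lines p \<and> z \<in> {1..p - 1}} =
        (\<lambda>(l, z). C l z) ` (affine_lines p \<times> {1..p - 1})"
    by auto
  then show ?thesis
    by (simp add: carrier_P_lattice finite_affine_lines)
qed

lemma fin_lattice_P: "fin_lattice P"
proof -
  have "Bot \<in> carrier P"
    by (simp add: carrier_P_lattice)
  then have "lattice P"
    using above_subset_plane le_iff_above above_inter_closed
    by (intro lattice_of_inter_closed[where b = Bot, OF eq_P_lattice finite_carrier_P inj_on_above])
      auto
  then show ?thesis
    using finite_carrier_P \<open>Bot \<in> carrier P\<close> by (auto simp: fin_lattice_def)
qed

lemma top_P: "\<top>\<^bsub>P\<^esub> = Top"
proof (rule top_eqI[OF partial_order_P])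
  have "Top \<in> carrier P"
    by (simp add: carrier_P_lattice)
  then show "greatest P Top (carrier P)"
    by (auto simp: greatest_def le_iff_above)
qed

section \<open>Moebius values\<close>

lemma lless_iff_above:
  "x \<in> carrier P \<Longrightarrow> y \<in> carrier P \<Longrightarrow> x \<sqsubset>\<^bsub>P\<^esub> y \<longleftrightarrow> pts y \<subset> pts x"
  using inj_onD[OF inj_on_above] by (auto simp: lless_def eq_P_lattice le_iff_above)

lemma moebius_P:
  assumes "v \<in> carrier P" "v \<noteq> Top"
  shows "moebius P v = - (\<Sum>u | u \<in> carrier P \<and> pts u \<subset> pts v. moebius P u)"
proof -
  have "{u. u \<in> carrier P \<and> v \<sqsubset>\<^bsub>P\<^esub> u} = {u. u \<in> carrier P \<and> pts u \<subset> pts v}"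
    using lless_iff_above assms(1) by blast
  then show ?thesis
    using assms partial_order_P finite_carrier_P
    by (subst moebius.simps) (simp add: top_P)
qed

lemma moebius_Top: "moebius P Top = 1"
  using partial_order_P finite_carrier_P by (subst moebius.simps) (simp add: top_P carrier_P_lattice)

lemma moebius_A:
  assumes "q \<in> plane p"
  shows "moebius P (A q) = -1"
proof -
  have "{u. u \<in> carrier P \<and> pts u \<subset> pts (A q)} = {Top}"
  proof (intro equalityI subsetI)
    fix u assume "u \<in> {u. u \<in> carrier P \<and> pts u \<subset> pts (A q)}"
    then have u: "u \<in> carrier P" "pts u = {}"
      by auto
    then have "card (pts u) = 0"
      by simp
    then show "u \<in> {Top}"
      using card_above[OF u(1)] two_less by (auto split: elt.splits)
  qed (auto simp: carrier_P_lattice)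
  then show ?thesis
    using assms by (subst moebius_P) (auto simp: carrier_P_lattice moebius_Top)
qed

lemma sum_moebius_A:
  assumes "Q \<subseteq> plane p"
  shows "(\<Sum>u\<in>A ` Q. moebius P u) = - int (card Q)"
proof -
  have "(\<Sum>u\<in>A ` Q. moebius P u) = (\<Sum>q\<in>Q. -1)"
    using assms by (intro sum.reindex_cong[of A]) (auto simp: inj_on_def moebius_A)
  then show ?thesis
    by simp
qed

lemma moebius_C:
  assumes l: "l \<in> affine_lines p" and z: "z \<in> {1..p - 1}"
  shows "moebius P (C l z) = 1"
proof -
  have sub: "pr l z \<subseteq> plane p"
    using pair_subset[OF l z] line_subset[OF l] by blast
  have C: "C l z \<in> carrier P"
    using l z by (auto simp: carrier_P_lattice)
  have "{u. u \<in> carrier P \<and> pts u \<subset> pts (C l z)} = {Top} \<union> A ` pr l z"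
  proof (intro equalityI subsetI)
    fix u assume "u \<in> {u. u \<in> carrier P \<and> pts u \<subset> pts (C l z)}"
    then have u: "u \<in> carrier P" "pts u \<subset> pr l z"
      by auto
    then have "card (pts u) < 2"
      using psubset_card_mono[OF finite_pair[OF l z]] card_pair[OF l z] by metis
    then have "card (pts u) < 2 \<and> u \<in> carrier P"
      using u by simp
    with u(1) show "u \<in> {Top} \<union> A ` pr l z"
      by (cases u rule: carrier_cases)
        (use card_above[OF u(1)] two_less card_line_less_plane u in auto)
  next
    fix u assume u: "u \<in> {Top} \<union> A ` pr l z"
    then have "pts u \<subseteq> pr l z" "card (pts u) \<le> 1"
      by auto
    then have "pts u \<subset> pr l z"
      using card_pair[OF l z] by auto
    moreover have "u \<in> carrier P"
      using u sub by (auto simp: carrier_P_lattice)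
    ultimately show "u \<in> {u. u \<in> carrier P \<and> pts u \<subset> pts (C l z)}"
      by simp
  qed
  moreover have "(\<Sum>u\<in>{Top} \<union> A ` pr l z. moebius P u) =
      (\<Sum>u\<in>{Top}. moebius P u) + (\<Sum>u\<in>A ` pr l z. moebius P u)"
    using finite_pair[OF l z] by (intro sum.union_disjoint) auto
  ultimately show ?thesis
    using moebius_P[OF C] by (simp add: moebius_Top sum_moebius_A[OF sub] card_pair[OF l z])
qed

text \<open>Above \<open>B l\<close> lie \<open>Top\<close>, \<open>p\<close> points and
  \<open>p - 1\<close> level-2 elements, with values 1, -1 and 1, so the sum vanishes. This fixes
  the number of level-2 elements per line.\<close>

lemma moebius_B:
  assumes l: "l \<in> affine_lines p"
  shows "moebius P (B l) = 0"
proof -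
  have sub: "l \<subseteq> plane p"
    using line_subset[OF l] by blast
  have B: "B l \<in> carrier P"
    using l by (auto simp: carrier_P_lattice)
  have proper: "D \<subset> l" if "D \<subseteq> l" "card D \<le> 2" for D
    using that card_line[OF l] two_less by auto
  have "{u. u \<in> carrier P \<and> pts u \<subset> pts (B l)} = {Top} \<union> A ` l \<union> C l ` {1..p - 1}"
  proof (intro equalityI subsetI)
    fix u assume "u \<in> {u. u \<in> carrier P \<and> pts u \<subset> pts (B l)}"
    then have u: "u \<in> carrier P" "pts u \<subset> l"
      by auto
    then have card: "card (pts u) < p"
      using psubset_card_mono[OF finite_line[OF l]] card_line[OF l] by metis
    from u(1) show "u \<in> {Top} \<union> A ` l \<union> C l ` {1..p - 1}"
    proof (cases u rule: carrier_cases)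
      case (C l' z)
      then have "l' = l"
        using line_of_pair[OF C(2,3) l] u by auto
      then show ?thesis
        using C by blast
    qed (use card card_above[OF u(1)] card_line_less_plane u in auto)
  next
    fix u assume "u \<in> {Top} \<union> A ` l \<union> C l ` {1..p - 1}"
    then consider "u = Top" | q where "u = A q" "q \<in> l" | z where "u = C l z" "z \<in> {1..p - 1}"
      by blast
    then show "u \<in> {u. u \<in> carrier P \<and> pts u \<subset> pts (B l)}"
    proof cases
      case 3
      then have "u \<in> carrier P"
        using l by (auto simp: carrier_P_lattice)
      then show ?thesis
        using proper[of "pr l z"] pair_subset[OF l 3(2)] card_pair[OF l 3(2)] 3 by simp
    qed (use sub proper[of "{}"] proper[of "{_}"] in \<open>auto simp: carrier_P_lattice\<close>)
  qed
  moreover have "(\<Sum>u\<in>C l ` {1..p - 1}. moebius P u) = int (p - 1)"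
  proof -
    have "(\<Sum>u\<in>C l ` {1..p - 1}. moebius P u) = (\<Sum>z\<in>{1..p - 1}. 1)"
      using l moebius_C by (intro sum.reindex_cong[of "C l"]) (auto simp: inj_on_def)
    then show ?thesis
      by simp
  qed
  moreover have "(\<Sum>u\<in>{Top} \<union> A ` l \<union> C l ` {1..p - 1}. moebius P u) =
      (\<Sum>u\<in>{Top} \<union> A ` l. moebius P u) + (\<Sum>u\<in>C l ` {1..p - 1}. moebius P u)"
    using finite_line[OF l] by (intro sum.union_disjoint) auto
  moreover have "(\<Sum>u\<in>{Top} \<union> A ` l. moebius P u) =
      (\<Sum>u\<in>{Top}. moebius P u) + (\<Sum>u\<in>A ` l. moebius P u)"
    using finite_line[OF l] by (intro sum.union_disjoint) auto
  ultimately show ?thesis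
    using B sub two_less
    by (subst moebius_P) (auto simp: moebius_Top sum_moebius_A card_line[OF l] simp del: Un_insert_left)
qed

section \<open>The linear equation of a line\<close>

lemma mem_down_set: "v \<in> carrier P \<Longrightarrow> u \<in> down_set P v \<longleftrightarrow> u \<in> carrier P \<and> pts v \<subseteq> pts u"
  by (auto simp: down_set_def le_iff_above)

lemma da_state_subset: "is_da_tree P t \<Longrightarrow> da_state P t \<subseteq> carrier P"
  by (induction t) (auto simp: down_set_def)

text \<open>For \<open>X\<close> without \<open>Top\<close>, this is the coefficient of the down-set
  of \<open>B l\<close> when the indicator of \<open>X\<close> is expanded in indicators of
  down-sets. The coefficient at \<open>A q\<close> is the indicator there, the one at
  \<open>C l z\<close> is its indicator minus those of its two parents, and the one at
  \<open>B l\<close> is its indicator minus all coefficients above it.\<close>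

definition line_defect :: "point set \<Rightarrow> elt set \<Rightarrow> int" where
  "line_defect l X = of_bool (B l \<in> X) - (\<Sum>q\<in>l. of_bool (A q \<in> X))
     - (\<Sum>z\<in>{1..p - 1}. of_bool (C l z \<in> X) - (\<Sum>q\<in>pr l z. of_bool (A q \<in> X)))"

lemma line_defect_union:
  assumes "X \<inter> Y = {}"
  shows "line_defect l (X \<union> Y) = line_defect l X + line_defect l Y"
proof -
  have "of_bool (x \<in> X \<union> Y) = (of_bool (x \<in> X) + of_bool (x \<in> Y) :: int)" for x
    using assms by auto
  then show ?thesis
    by (simp add: line_defect_def sum.distrib sum_subtractf)
qed

lemma line_defect_diff:
  assumes "Y \<subseteq> X"
  shows "line_defect l (X - Y) = line_defect l X - line_defect l Y"
proof -
  have "(X - Y) \<union> Y = X" "(X - Y) \<inter> Y = {}"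
    using assms by auto
  then show ?thesis
    using line_defect_union[of "X - Y" Y l] by simp
qed

text \<open>The terms of \<open>B l\<close> and of the points of \<open>l\<close> agree, both
  testing whether \<open>q\<close> lies on \<open>l\<close>; for each \<open>z\<close>, the term of
  \<open>C l z\<close> cancels against the points of its pair.\<close>

lemma line_defect_down_A:
  assumes l: "l \<in> affine_lines p" and q: "q \<in> plane p"
  shows "line_defect l (down_set P (A q)) = 0"
proof -
  have car: "A q \<in> carrier P" "B l \<in> carrier P" "\<And>z. z \<in> {1..p - 1} \<Longrightarrow> C l z \<in> carrier P"
    "\<And>q'. q' \<in> l \<Longrightarrow> A q' \<in> carrier P"
    using l q line_subset by (auto simp: carrier_P_lattice)
  have mem: "A q' \<in> down_set P (A q) \<longleftrightarrow> q = q'" if "q' \<in> l" for q'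
    using car(4)[OF that] by (simp add: mem_down_set[OF car(1)])
  have "(\<Sum>q'\<in>l. of_bool (A q' \<in> down_set P (A q))) = (of_bool (q \<in> l) :: int)"
    using mem sum_of_bool_eq[OF finite_line[OF l]] by simp
  moreover have "(\<Sum>q'\<in>pr l z. of_bool (A q' \<in> down_set P (A q))) = (of_bool (q \<in> pr l z) :: int)"
    if "z \<in> {1..p - 1}" for z
  proof -
    have "(\<Sum>q'\<in>pr l z. of_bool (A q' \<in> down_set P (A q))) = (\<Sum>q'\<in>pr l z. of_bool (q = q') :: int)"
      using mem pair_subset[OF l that] by (intro sum.cong refl arg_cong[of _ _ of_bool]) blast
    then show ?thesis
      using sum_of_bool_eq[OF finite_pair[OF l that], of q] by simp
  qed
  moreover have "C l z \<in> down_set P (A q) \<longleftrightarrow> q \<in> pr l z" if "z \<in> {1..p - 1}" for z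
    using car(3)[OF that] by (simp add: mem_down_set[OF car(1)])
  moreover have "B l \<in> down_set P (A q) \<longleftrightarrow> q \<in> l"
    using car(2) by (simp add: mem_down_set[OF car(1)])
  ultimately show ?thesis
    by (simp add: line_defect_def)
qed

text \<open>No \<open>A q\<close> lies below a level-2 element. If \<open>l = l'\<close>, exactly
  \<open>B l\<close> and \<open>C l z'\<close> contribute, and they cancel; otherwise nothing
  contributes.\<close>

lemma line_defect_down_C:
  assumes l: "l \<in> affine_lines p" and l': "l' \<in> affine_lines p" "z' \<in> {1..p - 1}"
  shows "line_defect l (down_set P (C l' z')) = 0"
proof -
  have car: "C l' z' \<in> carrier P" "B l \<in> carrier P" "\<And>z. z \<in> {1..p - 1} \<Longrightarrow> C l z \<in> carrier P"
    using l l' by (auto simp: carrier_P_lattice)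
  have "A q \<notin> down_set P (C l' z')" for q
  proof -
    have "\<not> pr l' z' \<subseteq> {q}"
      using card_pair[OF l'] card_mono[of "{q}" "pr l' z'"] by auto
    then show ?thesis
      by (simp add: mem_down_set[OF car(1)])
  qed
  moreover have "C l z \<in> down_set P (C l' z') \<longleftrightarrow> l = l' \<and> z' = z" if "z \<in> {1..p - 1}" for z
    using car(3)[OF that] pair_subset_pair[OF l' l that] by (auto simp: mem_down_set[OF car(1)])
  moreover have "B l \<in> down_set P (C l' z') \<longleftrightarrow> l = l'"
    using car(2) line_of_pair[OF l' l] pair_subset[OF l'] by (auto simp: mem_down_set[OF car(1)])
  moreover have "(\<Sum>z\<in>{1..p - 1}. of_bool (l = l' \<and> z' = z)) = (of_bool (l = l') :: int)"
    using l'(2) sum_of_bool_eq[of "{1..p - 1}" z'] by (cases "l = l'") auto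
  ultimately show ?thesis
    by (simp add: line_defect_def)
qed

lemma line_defect_down_Bot:
  assumes l: "l \<in> affine_lines p"
  shows "line_defect l (down_set P Bot) = 0"
proof -
  have Bot: "Bot \<in> carrier P"
    by (simp add: carrier_P_lattice)
  note mem = mem_down_set[OF Bot]
  have only: "u = Bot" if "u \<in> carrier P" "pts Bot \<subseteq> pts u" for u
  proof (rule inj_onD[OF inj_on_above _ that(1) Bot])
    show "pts u = pts Bot"
      using that above_subset_plane[OF that(1)] by simp
  qed
  have "A q \<notin> down_set P Bot" "C l z \<notin> down_set P Bot" "B l \<notin> down_set P Bot" for q z
    using only unfolding mem by blast+
  then show ?thesis
    by (simp add: line_defect_def)
qed

text \<open>The defect is additive on disjoint unions and on differences of nested sets, so leaves
  suffice. The only down-set with nonzero defect would be that of \<open>B l\<close>, and its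
  Moebius value 0 bars it from being a leaf.\<close>

lemma line_defect_da_state:
  assumes l: "l \<in> affine_lines p"
  shows "is_da_tree P t \<Longrightarrow> line_defect l (da_state P t) = 0"
proof (induction t)
  case Empty_Leaf
  show ?case
    by (simp add: line_defect_def)
next
  case (Leaf v)
  then have v: "v \<in> carrier P" "v \<noteq> Top" "moebius P v \<noteq> 0"
    by (simp_all add: top_P)
  from v(1) have "line_defect l (down_set P v) = 0"
  proof (cases v rule: carrier_cases)
    case (C l' z)
    then show ?thesis
      using line_defect_down_C[OF l C(2,3)] by simp
  qed (use v l moebius_B line_defect_down_A line_defect_down_Bot in auto)
  then show ?case
    by simp
qed (simp_all add: line_defect_union line_defect_diff)

section \<open>Points of a state\<close>

definition state_points :: "elt da_tree \<Rightarrow> point set" where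
  "state_points t = {q. A q \<in> da_state P t}"

lemma state_points_simps [simp]:
  "state_points Empty_Leaf = {}"
  "state_points (Plus t1 t2) = state_points t1 \<union> state_points t2"
  "state_points (Minus t1 t2) = state_points t1 - state_points t2"
  by (auto simp: state_points_def)

lemma state_points_subset: "is_da_tree P t \<Longrightarrow> state_points t \<subseteq> plane p"
  using da_state_subset by (auto simp: state_points_def carrier_P_lattice)

lemma state_points_meet_marked:
  assumes t: "is_da_tree P t" and l: "l \<in> affine_lines p"
    and two: "2 \<le> card (state_points t \<inter> l)"
  shows "state_points t \<inter> m l \<noteq> {}"
proof
  assume disj: "state_points t \<inter> m l = {}"
  let ?X = "da_state P t"
  \<comment> \<open>All pairs consist of marked points, so each level-2 term reduces to a bare
    indicator and is nonnegative; the equation then forces an indicator of at least 2.\<close>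
  have no_pair: "(\<Sum>q\<in>pr l z. of_bool (A q \<in> ?X)) = (0 :: int)" if "z \<in> {1..p - 1}" for z
    using disj pair_subset_marked[OF l that] by (intro sum.neutral) (auto simp: state_points_def)
  have "(\<Sum>q\<in>l. of_bool (A q \<in> ?X)) = int (card (state_points t \<inter> l))"
    using finite_line[OF l] by (simp add: state_points_def Int_def conj_commute)
  then have "(2 :: int) \<le> (\<Sum>q\<in>l. of_bool (A q \<in> ?X))"
    using two by simp
  moreover have "0 \<le> (\<Sum>z\<in>{1..p - 1}. of_bool (C l z \<in> ?X) - (\<Sum>q\<in>pr l z. of_bool (A q \<in> ?X)) :: int)"
    using no_pair by (intro sum_nonneg) simp
  ultimately have "2 \<le> (of_bool (B l \<in> ?X) :: int)"
    using line_defect_da_state[OF l t] unfolding line_defect_def by linarith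
  then show False
    by (simp add: of_bool_def split: if_splits)
qed

text \<open>An element other than \<open>Top\<close> has some point \<open>q\<close> above it, and a
  level-1 element below it can only be \<open>A q\<close>.\<close>

lemma card_state_points_Leaf:
  assumes "is_da_tree P (Leaf v)"
  shows "card (state_points (Leaf v)) \<le> 1"
proof -
  have v: "v \<in> carrier P" "v \<noteq> Top"
    using assms by (simp_all add: top_P)
  then have "pts v \<noteq> {}"
    using card_above[OF v(1)] two_less by (auto split: elt.splits)
  then obtain q where "q \<in> pts v"
    by blast
  then have "state_points (Leaf v) \<subseteq> {q}"
    by (auto simp: state_points_def mem_down_set[OF v(1)])
  then show ?thesis
    using card_mono[of "{q}"] by simp
qed

lemma exists_medium_subtree:
  assumes "1 < N"
  shows "is_da_tree P t \<Longrightarrow> N \<le> card (state_points t) \<Longrightarrow>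
    \<exists>t'. is_da_tree P t' \<and> N \<le> card (state_points t') \<and> card (state_points t') < 2 * N"
proof (induction t)
  case (Leaf v)
  then show ?case
    using card_state_points_Leaf[of v] assms by simp
next
  case (Plus t1 t2)
  show ?case
  proof (cases "N \<le> card (state_points t1) \<or> N \<le> card (state_points t2)")
    \<comment> \<open>Both children have fewer than \<open>N\<close> points, so this node is itself
      the one sought; in the other cases the search descends.\<close>
    case False
    then have "card (state_points (Plus t1 t2)) < 2 * N"
      using card_Un_le[of "state_points t1" "state_points t2"] by simp
    then show ?thesis
      using Plus.prems by blast
  qed (use Plus in auto)
next
  case (Minus t1 t2)
  have "card (state_points (Minus t1 t2)) \<le> card (state_points t1)"
    using state_points_subset[of t1] Minus.prems finite_subset[OF _ finite_plane]
    by (intro card_mono) auto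
  then show ?case
    using Minus by simp
qed (use assms in simp)

lemma not_winning:
  assumes "4 \<le> p"
    and missed: "\<And>T. T \<subseteq> plane p \<Longrightarrow> 4 * p \<le> card T \<Longrightarrow> card T < 8 * p \<Longrightarrow>
      \<exists>l\<in>affine_lines p. 2 \<le> card (T \<inter> l) \<and> T \<inter> m l = {}"
  shows "\<not> winning P t"
proof
  assume "winning P t"
  then have t: "is_da_tree P t" "da_state P t = carrier P - {Top}"
    by (simp_all add: winning_def top_P)
  then have "state_points t = plane p"
    by (auto simp: state_points_def carrier_P_lattice)
  \<comment> \<open>The root of a winning tree holds all \<open>p\<^sup>2\<close> points, enough to
    start the descent with threshold \<open>4 * p\<close>.\<close>
  then have "4 * p \<le> card (state_points t)"
    using assms(1) by (simp add: card_plane power2_eq_square)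
  then obtain t' where "is_da_tree P t'" "4 * p \<le> card (state_points t')"
      "card (state_points t') < 2 * (4 * p)"
    using exists_medium_subtree[OF _ t(1), of "4 * p"] assms(1) by auto
  then show False
    using missed[of "state_points t'"] state_points_subset[of t'] state_points_meet_marked[of t']
    by auto
qed

end

section \<open>The random marking\<close>

lemma card_medium_affine_lines:
  assumes prime: "prime p" and T: "T \<subseteq> plane p" "4 * p \<le> card T" "card T < 8 * p"
  shows "p\<^sup>2 \<le> 2 * card {l \<in> affine_lines p. card (T \<inter> l) \<in> {2..16}}"
proof -
  have "card {l \<in> slope_lines p. q \<in> l \<and> q' \<in> l} \<le> 1" if "q \<noteq> q'" for q q'
  proof -
    have "l = l'" if "l \<in> slope_lines p" "l' \<in> slope_lines p" "q \<in> l" "q' \<in> l" "q \<in> l'" "q' \<in> l'"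
      for l l'
      using affine_line_unique[OF prime _ _ \<open>q \<noteq> q'\<close>] slope_lines_subset[OF prime] that by blast
    then show ?thesis
      using finite_slope_lines[of p] by (simp add: card_le_Suc0_iff_eq)
  qed
  then have "p\<^sup>2 \<le> 2 * card {l \<in> slope_lines p. card (T \<inter> l) \<in> {2..16}}"
    using T prime_gt_0_nat[OF prime] card_slope_lines_through[OF prime]
    by (intro card_medium_lines finite_slope_lines card_slope_lines[OF prime]
        finite_subset[OF T(1) finite_plane]) auto
  also have "\<dots> \<le> 2 * card {l \<in> affine_lines p. card (T \<inter> l) \<in> {2..16}}"
    using slope_lines_subset[OF prime] finite_affine_lines
    by (intro mult_le_mono2 card_mono) auto
  finally show ?thesis .
qed

text \<open>A union bound over all \<open>T\<close>: a uniformly random marking meets each of the at least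
  \<open>p\<^sup>2 / 2\<close> lines with few but at least two points of \<open>T\<close> inside \<open>T\<close> with probability at
  most \<open>1 / 2\<close>, independently, and there are at most \<open>p ^ (16 * p)\<close> sets \<open>T\<close>.\<close>

lemma exists_missing_marking:
  assumes prime: "prime p" and p: "384 \<le> p" and w: "0 < w" "32 * w \<le> p"
  shows "\<exists>m. marking p m \<and> (\<forall>l\<in>affine_lines p. card (m l) = w) \<and>
    (\<forall>T. T \<subseteq> plane p \<longrightarrow> 4 * p \<le> card T \<longrightarrow> card T < 8 * p \<longrightarrow>
      (\<exists>l\<in>affine_lines p. 2 \<le> card (T \<inter> l) \<and> T \<inter> m l = {}))"
proof (rule ccontr)
  assume none: "\<not> ?thesis"
  let ?I = "affine_lines p"
  define X where "X l = subsets_of_card l w" for l :: "point set"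
  define J where "J T = {l \<in> ?I. card (T \<inter> l) \<in> {2..16}}" for T
  \<comment> \<open>The product of the \<open>Y T l\<close> consists of the markings that are bad
    for \<open>T\<close>: they meet \<open>T\<close> on every line with 2 to 16 points of
    \<open>T\<close>.\<close>
  define Y where "Y T l = (if l \<in> J T then {S \<in> X l. (T \<inter> l) \<inter> S \<noteq> {}} else X l)" for T l
  define \<T> where "\<T> = {T. T \<subseteq> plane p \<and> 4 * p \<le> card T \<and> card T < 8 * p}"
  \<comment> \<open>Half of \<open>p\<^sup>2\<close> rounded up, since \<open>p\<^sup>2\<close> may
    be odd; the number of medium lines is an integer and so reaches it.\<close>
  define h where "h = (p\<^sup>2 + 1) div 2"
  have finI: "finite ?I"
    by (rule finite_affine_lines)
  have finl: "finite l" "card l = p" if "l \<in> ?I" for l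
    using that finite_affine_line card_affine_line[OF prime] by auto
  have card_X: "card (X l) = p choose w" if "l \<in> ?I" for l
    using finl[OF that] by (simp add: X_def card_subsets_of_card)
  have finX: "finite (X l)" if "l \<in> ?I" for l
    using finl[OF that] by (simp add: X_def finite_subsets_of_card)
  have \<T>: "finite \<T>" "card \<T> \<le> (p\<^sup>2) ^ (8 * p)"
  proof -
    let ?N = "{T. T \<subseteq> plane p \<and> T \<noteq> {} \<and> card T \<le> 8 * p}"
    have sub: "\<T> \<subseteq> ?N"
      using p by (auto simp: \<T>_def)
    have N: "finite ?N" "card ?N \<le> (p\<^sup>2) ^ (8 * p)"
      using card_bounded_subsets_le[OF finite_plane, of p "8 * p"] unfolding card_plane .
    show "finite \<T>"
      using sub N(1) by (rule finite_subset)
    show "card \<T> \<le> (p\<^sup>2) ^ (8 * p)"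
      using card_mono[OF N(1) sub] N(2) by (rule le_trans)
  qed
  \<comment> \<open>By the contradiction hypothesis every marking is bad for some
    \<open>T\<close>.\<close>
  have cover: "(\<Pi>\<^sub>E l\<in>?I. X l) \<subseteq> (\<Union>T\<in>\<T>. \<Pi>\<^sub>E l\<in>?I. Y T l)"
  proof
    fix m assume m: "m \<in> (\<Pi>\<^sub>E l\<in>?I. X l)"
    then have m': "marking p m" "\<forall>l\<in>?I. card (m l) = w"
      by (auto simp: marking_def X_def subsets_of_card_def PiE_iff)
    have "\<not> (\<forall>T\<in>\<T>. \<exists>l\<in>?I. 2 \<le> card (T \<inter> l) \<and> T \<inter> m l = {})"
    proof
      assume "\<forall>T\<in>\<T>. \<exists>l\<in>?I. 2 \<le> card (T \<inter> l) \<and> T \<inter> m l = {}"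
      then show False
        using m' by - (rule notE[OF none], rule exI[of _ m], simp add: \<T>_def)
    qed
    then obtain T where T: "T \<in> \<T>" "\<And>l. l \<in> ?I \<Longrightarrow> 2 \<le> card (T \<inter> l) \<Longrightarrow> T \<inter> m l \<noteq> {}"
      by blast
    have "m l \<in> Y T l" if l: "l \<in> ?I" for l
    proof -
      have "m l \<in> X l" "m l \<subseteq> l"
        using m l by (auto simp: X_def subsets_of_card_def PiE_iff)
      moreover have "T \<inter> l \<inter> m l = T \<inter> m l"
        using \<open>m l \<subseteq> l\<close> by blast
      ultimately show ?thesis
        using T(2)[OF l] by (simp add: Y_def J_def)
    qed
    then show "m \<in> (\<Union>T\<in>\<T>. \<Pi>\<^sub>E l\<in>?I. Y T l)"
      using T(1) m by (auto simp: PiE_iff)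
  qed
  have bound: "2 ^ h * card (\<Pi>\<^sub>E l\<in>?I. Y T l) \<le> card (\<Pi>\<^sub>E l\<in>?I. X l)" if T: "T \<in> \<T>" for T
  proof -
    have "h \<le> card (J T)"
      using card_medium_affine_lines[OF prime, of T] T by (simp add: \<T>_def h_def J_def)
    then have "2 ^ h * card (\<Pi>\<^sub>E l\<in>?I. Y T l) \<le> 2 ^ card (J T) * card (\<Pi>\<^sub>E l\<in>?I. Y T l)"
      by (intro mult_le_mono1 power_increasing) auto
    also have "\<dots> \<le> card (\<Pi>\<^sub>E l\<in>?I. X l)"
    proof (rule card_PiE_half_le[OF finI])
      fix l assume "l \<in> J T"
      then have l: "l \<in> ?I" "card (T \<inter> l) \<le> 16" "l \<in> J T"
        by (auto simp: J_def)
      \<comment> \<open>At most 16 points of \<open>T\<close> on the line and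
        \<open>32 * w \<le> p\<close> give the hitting probability of at most one half.\<close>
      have "card (T \<inter> l) * w \<le> 16 * w"
        using l(2) by (rule mult_le_mono1)
      then have "2 * (card (T \<inter> l) * w) \<le> card l"
        using w(2) finl(2)[OF l(1)] by linarith
      then show "2 * card (Y T l) \<le> card (X l)"
        using card_subsets_hitting_le[of l "T \<inter> l" w] finl[OF l(1)] w(1) l(3) card_X[OF l(1)]
        by (simp add: Y_def X_def)
    qed (auto simp: J_def Y_def)
    finally show ?thesis .
  qed
  have finY: "finite (\<Pi>\<^sub>E l\<in>?I. Y T l)" for T
    using finI finX by (intro finite_PiE) (auto simp: Y_def)
  have "2 ^ h * card (\<Pi>\<^sub>E l\<in>?I. X l) \<le> 2 ^ h * (\<Sum>T\<in>\<T>. card (\<Pi>\<^sub>E l\<in>?I. Y T l))"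
    using card_mono[OF _ cover] card_UN_le[OF \<T>(1), of "\<lambda>T. \<Pi>\<^sub>E l\<in>?I. Y T l"] \<T>(1) finY
    by (intro mult_le_mono2) (auto intro: le_trans)
  also have "\<dots> \<le> card \<T> * card (\<Pi>\<^sub>E l\<in>?I. X l)"
    unfolding sum_distrib_left using sum_mono[OF bound] by simp
  finally have "2 ^ h * card (\<Pi>\<^sub>E l\<in>?I. X l) \<le> card \<T> * card (\<Pi>\<^sub>E l\<in>?I. X l)" .
  moreover have "0 < card (\<Pi>\<^sub>E l\<in>?I. X l)"
    using w card_X by (simp add: card_PiE[OF finI] prod_pos zero_less_binomial_iff)
  ultimately have "2 ^ h \<le> (p\<^sup>2) ^ (8 * p)"
    using \<T>(2) by simp
  \<comment> \<open>Squaring removes the halving in \<open>h\<close>: the inequality becomes one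
    between \<open>p\<close>-th powers, with bases \<open>2 ^ p\<close> and
    \<open>p ^ 32\<close>.\<close>
  then have "(2 ^ h)\<^sup>2 \<le> ((p\<^sup>2) ^ (8 * p))\<^sup>2"
    by (rule power_mono) simp
  also have "((p\<^sup>2) ^ (8 * p))\<^sup>2 = (p ^ 32) ^ p"
    by (simp flip: power_mult add: mult_ac)
  also have "\<dots> < (2 ^ p) ^ p"
    using power_32_less_two_power[OF p] p by (intro power_strict_mono) auto
  also have "(2 ^ p) ^ p = (2 :: nat) ^ p\<^sup>2"
    by (simp flip: power_mult add: power2_eq_square)
  also have "\<dots> \<le> 2 ^ (h * 2)"
    by (intro power_increasing) (auto simp: h_def)
  finally show False
    by (simp add: power_mult)
qed

section \<open>Choice of the pairs and size of the marking\<close>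

lemma exists_covering_pairs:
  fixes M :: "'a set"
  assumes "finite M" "2 \<le> card M" "card M - 1 \<le> n" "n \<le> card M choose 2"
  shows "\<exists>f. (\<forall>z\<in>{1..n}. f z \<subseteq> M \<and> card (f z) = 2) \<and> inj_on f {1..n} \<and> (\<Union>z\<in>{1..n}. f z) = M"
proof -
  obtain a where a: "a \<in> M"
    using assms by fastforce
  \<comment> \<open>The star at \<open>a\<close> covers \<open>M\<close> with
    \<open>card M - 1\<close> pairs; adding further pairs up to \<open>n\<close> in total keeps it
    covering.\<close>
  define St where "St = (\<lambda>b. {a, b}) ` (M - {a})"
  define Pairs where "Pairs = {S. S \<subseteq> M \<and> card S = 2}"
  have "card St \<le> n"
    using card_image_le[of "M - {a}" "\<lambda>b. {a, b}"] assms a by (simp add: St_def)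
  moreover have "n \<le> card Pairs"
    using assms by (simp add: Pairs_def n_subsets)
  moreover have "St \<subseteq> Pairs"
    using a by (auto simp: St_def Pairs_def)
  moreover have finP: "finite Pairs"
    using assms(1) by (auto simp: Pairs_def)
  ultimately obtain Q where Q: "St \<subseteq> Q" "Q \<subseteq> Pairs" "card Q = n"
    using exists_subset_between[of St n Pairs] by blast
  have "finite Q"
    using Q finP finite_subset by blast
  then obtain f where "bij_betw f {1..n} Q"
    using Q(3) by (metis ex_bij_betw_nat_finite_1)
  then have f: "inj_on f {1..n}" "f ` {1..n} = Q"
    by (auto simp: bij_betw_def)
  have "card (M - {a}) \<noteq> 0"
    using assms(2) card_Diff_singleton[OF a] by simp
  then have "M - {a} \<noteq> {}"
    by (metis card.empty)
  then have "\<Union>St = M"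
    using a by (auto simp: St_def)
  moreover have "\<Union>Q \<subseteq> M"
    using Q(2) by (auto simp: Pairs_def)
  ultimately have "\<Union>Q = M"
    using Q(1) by blast
  then show ?thesis
    using f Q(2) by (intro exI[of _ f]) (auto simp: Pairs_def)
qed

lemma exists_pair_choice:
  assumes "prime p" "marking p m" "\<And>l. l \<in> affine_lines p \<Longrightarrow> card (m l) = w"
    and "2 \<le> w" "w \<le> p" "p - 1 \<le> w choose 2"
  shows "\<exists>pr. pair_choice p m pr"
proof -
  have "\<exists>f. (\<forall>z\<in>{1..p - 1}. f z \<subseteq> m l \<and> card (f z) = 2) \<and> inj_on f {1..p - 1} \<and>
      (\<Union>z\<in>{1..p - 1}. f z) = m l" if l: "l \<in> affine_lines p" for l
  proof (rule exists_covering_pairs)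
    show "finite (m l)"
      using assms(3)[OF l] assms(4) by (metis card.infinite not_numeral_le_zero)
  qed (use assms(3)[OF l] assms(4-6) in auto)
  then show ?thesis
    unfolding pair_choice_def by metis
qed

lemma marking_size_bounds:
  fixes p :: nat
  assumes "10 ^ 5 \<le> p"
  defines "w \<equiv> nat \<lceil>sqrt (2 * real p)\<rceil> + 1"
  shows "2 \<le> w" "32 * w \<le> p" "p - 1 \<le> w choose 2"
proof -
  define s where "s = sqrt (2 * real p)"
  have p: "100000 \<le> real p"
    using assms(1) by simp
  have s: "0 < s" "s * s = 2 * real p"
    using p by (auto simp: s_def)
  have "s \<le> real p / 64"
    unfolding s_def
  proof (rule real_le_lsqrt)
    \<comment> \<open>The constant is \<open>2 * 64\<^sup>2\<close>. With
      \<open>s \<le> p / 64\<close> one gets \<open>32 * (s + 2) \<le> p / 2 + 64\<close>, which is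
      at most \<open>p\<close>.\<close>
    have "real p * 8192 \<le> real p * real p"
      using p by (intro mult_left_mono) auto
    then show "2 * real p \<le> (real p / 64)\<^sup>2"
      by (simp add: power2_eq_square field_simps)
  qed (use p in simp_all)
  have "w = nat \<lceil>s\<rceil> + 1"
    by (simp add: w_def s_def)
  then have w: "s \<le> real (w - 1)" "real w \<le> s + 2"
    using s(1) by (simp_all, linarith+)
  have "32 * real w \<le> real p"
    using w(2) \<open>s \<le> real p / 64\<close> p by linarith
  then show "32 * w \<le> p"
    by linarith
  have "0 < real (w - 1)"
    using w(1) s(1) by linarith
  then show w2: "2 \<le> w"
    by linarith
  \<comment> \<open>The summand 1 in \<open>w\<close> enters here: \<open>w - 1\<close> is at least
    the square root of \<open>2 * p\<close>, so there are at least \<open>p\<close> pairs of marked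
    points.\<close>
  have "2 * real p \<le> real (w - 1) * real (w - 1)"
    unfolding s(2)[symmetric] using w(1) s(1) by (intro mult_mono) auto
  also have "\<dots> \<le> real w * real (w - 1)"
    by (intro mult_right_mono) auto
  finally have "real (2 * p) \<le> real (w * (w - 1))"
    by (simp only: of_nat_mult of_nat_numeral)
  then have "2 * p \<le> w * (w - 1)"
    by (simp only: of_nat_le_iff)
  then show "p - 1 \<le> w choose 2"
    by (simp add: choose_two)
qed

theorem theorem1p1:
  shows "(\<forall>p::nat. prime p \<and> p \<ge> 10 ^ 5 \<longrightarrow>
           (\<exists>m. marking p m \<and>
                (\<forall>l\<in>affine_lines p. card (m l) = nat \<lceil>sqrt (2 * real p)\<rceil> + 1) \<and>
                (\<exists>pr. pair_choice p m pr) \<and>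
                (\<forall>pr. pair_choice p m pr \<longrightarrow>
                   fin_lattice (P_lattice p m pr) \<and>
                   \<not> (\<exists>t. winning (P_lattice p m pr) t))))
         \<and> \<not> NCI_conjecture"
proof -
  have counterexample: "\<exists>m. marking p m \<and>
      (\<forall>l\<in>affine_lines p. card (m l) = nat \<lceil>sqrt (2 * real p)\<rceil> + 1) \<and>
      (\<exists>pr. pair_choice p m pr) \<and>
      (\<forall>pr. pair_choice p m pr \<longrightarrow>
         fin_lattice (P_lattice p m pr) \<and> \<not> (\<exists>t. winning (P_lattice p m pr) t))"
    if prime: "prime p" and p: "10 ^ 5 \<le> p" for p :: nat
  proof -
    define w where "w = nat \<lceil>sqrt (2 * real p)\<rceil> + 1"
    have w: "2 \<le> w" "32 * w \<le> p" "p - 1 \<le> w choose 2"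
      using marking_size_bounds[OF p] by (simp_all add: w_def)
    obtain m where m: "marking p m" "\<forall>l\<in>affine_lines p. card (m l) = w"
      and missed: "\<And>T. T \<subseteq> plane p \<Longrightarrow> 4 * p \<le> card T \<Longrightarrow> card T < 8 * p \<Longrightarrow>
        \<exists>l\<in>affine_lines p. 2 \<le> card (T \<inter> l) \<and> T \<inter> m l = {}"
      using exists_missing_marking[OF prime, of w] p w by auto
    \<comment> \<open>Keeps the claim about all \<open>pr\<close> from being vacuous and supplies
      the concrete lattice that refutes the conjecture.\<close>
    have "\<exists>pr. pair_choice p m pr"
      using exists_pair_choice[OF prime m(1), of w] m(2) w by auto
    moreover have "fin_lattice (P_lattice p m pr) \<and> \<not> (\<exists>t. winning (P_lattice p m pr) t)"
      if "pair_choice p m pr" for pr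
    proof -
      interpret nci_lattice p m pr
        using prime p m(1) that by unfold_locales auto
      show ?thesis
        using fin_lattice_P not_winning[OF _ missed] p by auto
    qed
    ultimately show ?thesis
      using m unfolding w_def by blast
  qed
  moreover have "\<not> NCI_conjecture"
  proof
    assume NCI: NCI_conjecture
    obtain p :: nat where "prime p" "10 ^ 5 < p"
      using bigger_prime by blast
    then obtain m pr where "fin_lattice (P_lattice p m pr)" "\<not> (\<exists>t. winning (P_lattice p m pr) t)"
      using counterexample[of p] by auto
    then show False
      using NCI_conjecture_imp_winning[OF NCI] by blast
  qed
  ultimately show ?thesis
    by blast
qed

end
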